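(* Let $(P_n)_{n\in\mathbb{Z}_{\ge 1}}$ be any sequence of polynomials $P_n\in \mathbb{C}[X]$ of degree $\deg P_n=n$ satisfying $$\limsup_{n\to\infty} \left(h_{B}(P_n)+\tfrac{1}{2}-h_{\mathrm{FS}}(P_n)\right)\le 0,$$ and let $f\colon \mathbb{C}\to\mathbb{C}$ be any continuous function such that $\lim_{|z|\to\infty}f(z)$ exists and is finite. Then $$\lim_{n\to \infty}\frac{1}{n}\sum_{\substack{z\in\mathbb{C}\\ P_n(z)=0}}f(z)=\frac{i}{2\pi}\int_\mathbb{C}f(z)\frac{dz\wedge d\overline{z}}{\left(1+|z|^2\right)^2},$$ where the zeros of $P_n$ are counted with multiplicity.
   Context: For a polynomial $P=\sum_{k=0}^n a_kX^k=a_n\prod_{k=1}^{n}(X-\alpha_k)\in\mathbb{C}[X]$ with $a_n\neq 0$, $n\ge 1$, define $$h_{\mathrm{FS}}(P)=\tfrac{1}{n}\log|a_n|+\tfrac{1}{2n}\sum_{k=1}^n\log(1+|\alpha_k|^2), \qquad h_{B}(P)=\tfrac{1}{n}\log \max_{0\le k\le n}\frac{|a_k|}{\sqrt{\binom{n}{k}}}.$$ With $z=x+iy$ one has $\frac{i}{2\pi}dz\wedge d\overline{z}=\frac1\pi dx\,dy$. *)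

theory Defs
  imports
    "HOL-Analysis.Analysis"
    "HOL-Computational_Algebra.Computational_Algebra"
begin

text \<open>
  Both heights are meant for polynomials of degree at least 1; for constant polynomials the
  division by the degree makes them 0. The multiset \<open>proots P\<close> contains each complex root as often
  as its multiplicity, so the sum over it is the sum over \<open>\<alpha>\<^sub>1, \<dots>, \<alpha>\<^sub>n\<close>.
\<close>

definition h_FS :: "complex poly \<Rightarrow> real" where
  "h_FS P = 1 / real (degree P) * ln (cmod (lead_coeff P))
          + 1 / (2 * real (degree P)) * (\<Sum>\<alpha>\<in>#proots P. ln (1 + (cmod \<alpha>)\<^sup>2))"

definition h_B :: "complex poly \<Rightarrow> real" where
  "h_B P = 1 / real (degree P) *
     ln (Max ((\<lambda>k. cmod (coeff P k) / sqrt (real (degree P choose k))) ` {0..degree P}))"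

text \<open>
  The integral of \<open>g\<close> against the area form \<open>\<i>/(2\<pi>) dz \<and> d(cnj z)\<close>, which is \<open>1/\<pi> dx dy\<close> for
  \<open>z = x + \<i>y\<close>; Lebesgue measure \<open>lborel\<close> on the complex plane is \<open>dx dy\<close>.
\<close>

definition area_form_integral :: "(complex \<Rightarrow> complex) \<Rightarrow> complex" where
  "area_form_integral g = 1 / complex_of_real pi * (LINT z|lborel. g z)"

end

theory Submission
  imports Defs "HOL-Real_Asymp.Real_Asymp" "HOL-Probability.Probability_Measure"
begin

text \<open>
  Let \<open>\<omega>\<close> be the Fubini--Study probability measure and
  \<open>G z a = ln (1 + |z|\<^sup>2) / 2 + ln (1 + |a|\<^sup>2) / 2 - ln |z - a|\<close>, a nonnegative kernel with
  \<open>\<integral> G z a d\<omega>(z) = 1/2\<close> for every \<open>a\<close>. If \<open>w\<^sub>n z\<close> is the average of \<open>G z a\<close> over the zeros \<open>a\<close> of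
  \<open>P\<^sub>n\<close>, then \<open>w\<^sub>n = h_FS P\<^sub>n + ln (1 + |z|\<^sup>2) / 2 - ln |P\<^sub>n z| / n\<close> is, off those zeros, at least
  \<open>h_FS P\<^sub>n - h_B P\<^sub>n - ln (n + 1) / (2 * n)\<close>, by Cauchy--Schwarz. The hypothesis on the heights
  therefore makes \<open>w\<^sub>n\<close> asymptotically at least its mean \<open>1/2\<close>, so \<open>w\<^sub>n \<longlonglongrightarrow> 1/2\<close> in \<open>L\<^sup>1(\<omega>)\<close>.
  Integrating against a bounded density \<open>\<eta>\<close> gives equidistribution for the test function
  \<open>a \<mapsto> \<integral> G z a * \<eta> z d\<omega>(z)\<close>. By Jensen's formula, the difference of the uniform distributions on
  two concentric annuli has as its potential, up to a constant, a compactly supported bump.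
  Convolutions with small bumps approximate every compactly supported continuous function
  uniformly, and these together with the constants approximate every \<open>f\<close> in the statement.
\<close>

section \<open>Lebesgue measure on the complex plane under rotations\<close>

lemma nn_integral_lborel_translate:
  fixes a :: "'a::euclidean_space"
  assumes [measurable]: "f \<in> borel_measurable borel"
  shows "(\<integral>\<^sup>+x. f (a + x) \<partial>lborel) = (\<integral>\<^sup>+x. f x \<partial>lborel)"
proof -
  have "(\<integral>\<^sup>+x. f x \<partial>lborel) = (\<integral>\<^sup>+x. f x \<partial>(distr lborel borel (\<lambda>x. a + x)))"
    using lborel_affine[of 1 a] by (simp add: density_1)
  then show ?thesis by (simp add: nn_integral_distr)
qed

lemma distr_lborel_translate:
  fixes a :: "'a::euclidean_space"
  shows "distr lborel borel (\<lambda>x. a + x) = lborel"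
  using lborel_affine[of 1 a] by (simp add: density_1)

lemma integral_lborel_translate:
  fixes a :: "'a::euclidean_space" and f :: "'a \<Rightarrow> 'b::{banach, second_countable_topology}"
  assumes [measurable]: "f \<in> borel_measurable borel"
  shows "(LINT x|lborel. f (a + x)) = (LINT x|lborel. f x)"
  by (subst (2) distr_lborel_translate[of a, symmetric]) (simp add: integral_distr)

text \<open>Uniqueness of Haar measure, specialised: integrate
  \<open>1\<^sub>U (f x) * 1\<^sub>B (f x + y)\<close> over \<open>(x, y)\<close> in both orders, with \<open>U\<close> the unit ball.\<close>

lemma distr_lborel_isometry:
  fixes f :: "'a::euclidean_space \<Rightarrow> 'a"
  assumes lin: "linear f" and iso: "\<And>x. norm (f x) = norm x" and surj: "surj f"
  shows "distr lborel borel f = lborel"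
proof (rule measure_eqI)
  have [measurable]: "f \<in> borel_measurable borel"
    by (intro borel_measurable_continuous_onI linear_continuous_on linear_conv_bounded_linear[THEN iffD1] lin)
  show "sets (distr lborel borel f) = sets lborel" by simp
  fix B assume "B \<in> sets (distr lborel borel f)"
  then have [measurable]: "B \<in> sets borel" by simp
  define U where "U = ball (0::'a) 1"
  have [measurable]: "U \<in> sets borel" by (simp add: U_def)
  have ball: "emeasure lborel (ball x 1 :: 'a set) = emeasure lborel U" for x
    by (simp add: U_def emeasure_ball)
  have "emeasure lborel U * emeasure lborel B =
      (\<integral>\<^sup>+x. (\<integral>\<^sup>+y. indicator U (f x) * indicator B (f x + y) \<partial>lborel) \<partial>lborel)"
  proof -
    have "(\<integral>\<^sup>+y. indicator U (f x) * indicator B (f x + y) \<partial>lborel) =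
        indicator U x * emeasure lborel B" for x
    proof -
      have "(\<integral>\<^sup>+y. indicator B (f x + y) \<partial>lborel) = emeasure lborel B"
        by (subst nn_integral_lborel_translate) auto
      moreover have "f x \<in> U \<longleftrightarrow> x \<in> U" by (simp add: U_def iso)
      ultimately show ?thesis by (subst nn_integral_cmult) (auto simp: indicator_def)
    qed
    then show ?thesis by (simp add: nn_integral_multc)
  qed
  also have "\<dots> = (\<integral>\<^sup>+y. (\<integral>\<^sup>+x. indicator U (f x) * indicator B (f x + y) \<partial>lborel) \<partial>lborel)"
    by (rule lborel_pair.Fubini'[symmetric]) measurable
  \<comment> \<open>For fixed \<open>y\<close>, translating \<open>x\<close> by a preimage
    \<open>w\<close> of \<open>- y\<close> moves \<open>y\<close> from the second factor into the
    first. This is where surjectivity enters.\<close>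
  also have "\<dots> = (\<integral>\<^sup>+y. (\<integral>\<^sup>+x. indicator U (f x - y) * indicator B (f x) \<partial>lborel) \<partial>lborel)"
  proof (rule nn_integral_cong)
    fix y :: 'a
    obtain w where w: "f w = - y" using surj by (metis surjD)
    have "(\<integral>\<^sup>+x. indicator U (f x) * indicator B (f x + y) \<partial>lborel) =
      (\<integral>\<^sup>+x. indicator U (f (w + x)) * indicator B (f (w + x) + y) \<partial>lborel)"
      by (rule nn_integral_lborel_translate[symmetric]) measurable
    also have "\<dots> = (\<integral>\<^sup>+x. indicator U (f x - y) * indicator B (f x) \<partial>lborel)"
      by (simp add: linear_add[OF lin] w)
    finally show "(\<integral>\<^sup>+x. indicator U (f x) * indicator B (f x + y) \<partial>lborel) = \<dots>" .
  qed
  also have "\<dots> = (\<integral>\<^sup>+x. (\<integral>\<^sup>+y. indicator U (f x - y) * indicator B (f x) \<partial>lborel) \<partial>lborel)"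
    by (rule lborel_pair.Fubini') measurable
  \<comment> \<open>The section in \<open>y\<close> is the unit ball about \<open>f x\<close>, whose
    volume does not depend on its centre.\<close>
  also have "\<dots> = (\<integral>\<^sup>+x. emeasure lborel U * indicator B (f x) \<partial>lborel)"
  proof (rule nn_integral_cong)
    fix x
    have "(\<integral>\<^sup>+y. indicator U (f x - y) * indicator B (f x) \<partial>lborel) =
      (\<integral>\<^sup>+y. indicator (ball (f x) 1) y \<partial>lborel) * indicator B (f x)"
      by (subst nn_integral_multc[symmetric])
        (auto simp: U_def indicator_def dist_norm norm_minus_commute
          intro!: nn_integral_cong borel_measurable_indicator)
    then show "(\<integral>\<^sup>+y. indicator U (f x - y) * indicator B (f x) \<partial>lborel) =
      emeasure lborel U * indicator B (f x)" by (simp add: ball)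
  qed
  also have "\<dots> = emeasure lborel U * emeasure (distr lborel borel f) B"
  proof -
    have "(\<integral>\<^sup>+x. indicator B (f x) \<partial>lborel) = (\<integral>\<^sup>+x. indicator B x \<partial>distr lborel borel f)"
      by (rule nn_integral_distr[symmetric]) auto
    then show ?thesis by (simp add: nn_integral_cmult)
  qed
  \<comment> \<open>The unit ball has positive finite volume, so this factor cancels.\<close>
  finally show "emeasure (distr lborel borel f) B = emeasure lborel B"
    by (subst (asm) ennreal_mult_cancel_left)
      (auto simp: U_def emeasure_ball less_imp_neq[OF unit_ball_vol_pos, symmetric])
qed

lemma distr_lborel_complex_rotate:
  fixes c :: complex
  assumes "cmod c = 1"
  shows "distr lborel borel ((*) c) = lborel"
proof (rule distr_lborel_isometry)
  show "surj ((*) c)"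
    using assms by (intro surjI[of _ "\<lambda>x. x / c"]) auto
qed (use assms in \<open>auto simp: norm_mult linear_times\<close>)

text \<open>A rotation preserves both the modulus and Lebesgue measure, so it can be moved past the
  density.\<close>

lemma distr_density_radial_rotate:
  assumes [measurable]: "g \<in> borel_measurable borel" and c: "cmod c = 1"
  shows "distr (density lborel (\<lambda>z. g (cmod z))) borel ((*) c) = density lborel (\<lambda>z. g (cmod z))"
proof -
  have "density (distr lborel borel ((*) c)) (\<lambda>z. g (cmod z)) =
      distr (density lborel ((\<lambda>z. g (cmod z)) \<circ> (*) c)) borel ((*) c)"
    by (subst density_distr) (auto simp: comp_def)
  also have "(\<lambda>z. g (cmod z)) \<circ> (*) c = (\<lambda>z. g (cmod z))"
    by (simp add: fun_eq_iff norm_mult c)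
  finally show ?thesis by (simp add: distr_lborel_complex_rotate[OF c])
qed

text \<open>The disc with squared radius \<open>t\<close> has area \<open>pi * t\<close>; hence the
  squared modulus carries planar Lebesgue measure to \<open>pi\<close> times Lebesgue measure on the
  half-line. This replaces polar coordinates.\<close>

lemma nn_integral_complex_radial:
  assumes [measurable]: "g \<in> borel_measurable borel"
  shows "(\<integral>\<^sup>+z. g ((cmod z)\<^sup>2) \<partial>lborel) = ennreal pi * (\<integral>\<^sup>+t. g t * indicator {0..} t \<partial>lborel)"
proof -
  \<comment> \<open>The sign is reversed so that the half-lines \<open>{x<..}\<close> pull back to
    open discs, which have finite measure; two measures on the line are compared on such
    half-lines.\<close>
  let ?M = "distr lborel borel (\<lambda>z. - (cmod z)\<^sup>2)"
  let ?N = "density lborel (\<lambda>t::real. ennreal pi * indicator {..0} t)"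
  have eq: "emeasure ?M {x<..} = emeasure ?N {x<..}" "emeasure ?M {x<..} < \<infinity>" for x
  proof -
    have *: "(\<lambda>z. - (cmod z)\<^sup>2) -` {x<..} = (if x < 0 then ball 0 (sqrt (-x)) else {})"
    proof (cases "x < 0")
      case True
      have "x < - (cmod z)\<^sup>2 \<longleftrightarrow> cmod z < sqrt (- x)" for z
        using real_less_rsqrt[of "cmod z" "-x"] real_sqrt_less_iff[of "(cmod z)\<^sup>2" "-x"]
        by (auto simp: real_sqrt_abs)
      with True show ?thesis by auto
    qed (auto, smt (verit) zero_le_power2)
    have m: "emeasure ?M {x<..} = ennreal (if x < 0 then pi * (- x) else 0)"
      by (subst emeasure_distr) (auto simp: * emeasure_ball unit_ball_vol_2)
    then show "emeasure ?M {x<..} < \<infinity>" by simp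
    have "emeasure ?N {x<..} = (\<integral>\<^sup>+t. ennreal pi * indicator {x<..0} t \<partial>lborel)"
      by (subst emeasure_density) (auto intro!: nn_integral_cong simp: indicator_def)
    also have "\<dots> = ennreal pi * emeasure lborel {x<..0}"
      by (simp add: nn_integral_cmult)
    also have "\<dots> = ennreal (if x < 0 then pi * (- x) else 0)"
      by (auto simp: ennreal_mult'[symmetric] emeasure_lborel_Ioc)
    finally show "emeasure ?M {x<..} = emeasure ?N {x<..}" using m by simp
  qed
  have MN: "?M = ?N"
    by (rule measure_eqI_lessThan) (use eq in auto)
  have "(\<integral>\<^sup>+z. g ((cmod z)\<^sup>2) \<partial>lborel) = (\<integral>\<^sup>+t. g (- t) \<partial>?M)"
    by (simp add: nn_integral_distr)
  also have "\<dots> = (\<integral>\<^sup>+t. ennreal pi * (g (- t) * indicator {0..} (- t)) \<partial>lborel)"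
    by (subst MN, subst nn_integral_density) (auto intro!: nn_integral_cong simp: indicator_def)
  also have "\<dots> = ennreal pi * (\<integral>\<^sup>+t. g (- t) * indicator {0..} (- t) \<partial>lborel)"
    by (simp add: nn_integral_cmult)
  also have "(\<integral>\<^sup>+t. g (- t) * indicator {0..} (- t) \<partial>lborel) =
      (\<integral>\<^sup>+t. g t * indicator {0..} t \<partial>(distr lborel borel uminus))"
    by (simp add: nn_integral_distr)
  finally show ?thesis by (simp add: lborel_distr_uminus)
qed

section \<open>Jensen's formula for rotation-invariant measures\<close>

definition rotation_invariant :: "complex measure \<Rightarrow> bool" where
  "rotation_invariant M \<longleftrightarrow> sets M = sets borel \<and> (\<forall>c. cmod c = 1 \<longrightarrow> distr M borel ((*) c) = M)"

lemma rotation_invariant_density_radial: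
  "g \<in> borel_measurable borel \<Longrightarrow> rotation_invariant (density lborel (\<lambda>z. g (cmod z)))"
  by (simp add: rotation_invariant_def distr_density_radial_rotate)

lemma integral_rotation_invariant:
  fixes h :: "complex \<Rightarrow> real"
  assumes "rotation_invariant M" "cmod c = 1" and [measurable]: "h \<in> borel_measurable borel"
  shows "(LINT z|M. h (c * z)) = (LINT z|M. h z)"
proof -
  have [measurable_cong]: "sets M = sets borel" and M: "distr M borel ((*) c) = M"
    using assms by (auto simp: rotation_invariant_def)
  have "(LINT z|M. h (c * z)) = (LINT z|distr M borel ((*) c). h z)"
    by (subst integral_distr) auto
  with M show ?thesis by simp
qed

text \<open>The modulus of \<open>1 - w\<close> lies between \<open>1 - r\<close> and
  \<open>2\<close>, and the right-hand side dominates the absolute value of both logarithms. It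
  supplies the uniform bounds needed for integrability.\<close>

lemma abs_ln_norm_one_minus_le:
  fixes w :: complex
  assumes "cmod w \<le> r" "r < 1"
  shows "\<bar>ln (cmod (1 - w))\<bar> \<le> - ln (1 - r) + ln 2"
proof -
  have r: "0 \<le> r" using assms(1) norm_ge_zero order_trans by blast
  have lo: "1 - r \<le> cmod (1 - w)"
    using norm_triangle_ineq2[of 1 w] assms by simp
  have "cmod (1 - w) \<le> 1 + cmod w" by (metis norm_one norm_triangle_ineq4)
  then have hi: "cmod (1 - w) \<le> 2" using assms by simp
  have "ln (cmod (1 - w)) \<le> ln 2" using lo hi assms by (subst ln_le_cancel_iff) auto
  moreover have "ln (1 - r) \<le> ln (cmod (1 - w))" using lo assms by (subst ln_le_cancel_iff) auto
  moreover have "ln (1 - r) \<le> 0" using r assms by simp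
  ultimately show ?thesis using ln_gt_zero[of 2] by linarith
qed

text \<open>Rotating by an \<open>m\<close>-th root of \<open>-1\<close> and averaging turns \<open>1 - q ^ m\<close> into
  \<open>1 - q ^ (2 * m)\<close> at the cost of a factor \<open>1/2\<close>; iterating this drives the integral to \<open>0\<close>.\<close>

lemma integral_ln_norm_one_minus_eq_0:
  fixes q :: "complex \<Rightarrow> complex"
  assumes M: "rotation_invariant M" "finite_measure M"
    and [measurable]: "q \<in> borel_measurable borel"
    and r: "r < 1" "\<And>z. cmod (q z) \<le> r"
    and eq: "\<And>c z. cmod c = 1 \<Longrightarrow> q (c * z) = c * q z \<or> q (c * z) = q z / c"
  shows "(LINT z|M. ln (cmod (1 - q z))) = 0"
proof -
  interpret finite_measure M by fact
  have [measurable_cong]: "sets M = sets borel" using M by (auto simp: rotation_invariant_def)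
  have r0: "0 \<le> r" using r(2)[of 0] norm_ge_zero order_trans by blast
  define C where "C = - ln (1 - r) + ln 2"
  define J where "J m = (LINT z|M. ln (cmod (1 - q z ^ m)))" for m :: nat
  \<comment> \<open>The values of \<open>s\<close> used below are \<open>1\<close> and
    \<open>-1\<close>, one for each factor of \<open>1 - q z ^ (2 * m)\<close>.\<close>
  have bnd: "\<bar>ln (cmod (1 - s * q z ^ m))\<bar> \<le> C" if "m \<ge> 1" "cmod s = 1" for m s z
    unfolding C_def
  proof (rule abs_ln_norm_one_minus_le)
    have "cmod (q z) ^ m \<le> r ^ m" using r by (intro power_mono) auto
    also have "\<dots> \<le> r ^ 1" using that r r0 by (intro power_decreasing) auto
    finally show "cmod (s * q z ^ m) \<le> r" by (simp add: norm_mult norm_power that)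
  qed fact
  have int: "integrable M (\<lambda>z. ln (cmod (1 - s * q z ^ m)))" if "m \<ge> 1" "cmod s = 1" for m s
    by (rule integrable_const_bound[of _ C]) (use bnd[OF that] in \<open>auto\<close>)
  have step: "J m = J (2 * m) / 2" if m: "m \<ge> 1" for m
  proof -
    define c where "c = cis (pi / m)"
    have "c ^ m = cis (real m * (pi / m))" by (simp only: c_def Complex.DeMoivre)
    then have cm: "c ^ m = - 1" "cmod c = 1" using m by (simp_all add: c_def)
    \<comment> \<open>Both alternatives in \<open>eq\<close> give the same sign, because
      \<open>-1\<close> is its own inverse.\<close>
    have qc: "q (c * z) ^ m = - (q z ^ m)" for z
      using eq[OF cm(2), of z] cm by (auto simp: power_mult_distrib power_divide)
    have "J m = (LINT z|M. ln (cmod (1 - q (c * z) ^ m)))"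
      unfolding J_def by (rule integral_rotation_invariant[symmetric]) (use M cm in auto)
    also have "\<dots> = (LINT z|M. ln (cmod (1 + q z ^ m)))" by (simp add: qc)
    finally have "2 * J m = (LINT z|M. ln (cmod (1 - q z ^ m))) + (LINT z|M. ln (cmod (1 + q z ^ m)))"
      by (simp add: J_def)
    also have "\<dots> = (LINT z|M. ln (cmod (1 - q z ^ m)) + ln (cmod (1 + q z ^ m)))"
      by (rule Bochner_Integration.integral_add[symmetric])
        (use int[OF m, of 1] int[OF m, of "-1"] in auto)
    also have "\<dots> = J (2 * m)"
      unfolding J_def
    proof (rule Bochner_Integration.integral_cong[OF refl])
      fix z
      have "cmod (q z) ^ m < 1"
      proof -
        have "cmod (q z) ^ m \<le> cmod (q z) ^ 1"
          using m r(1) r(2)[of z] by (intro power_decreasing) auto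
        then show ?thesis using r(1) r(2)[of z] by simp
      qed
      \<comment> \<open>Neither factor vanishes, so the logarithm of the product really
        splits.\<close>
      then have "q z ^ m \<noteq> 1" "q z ^ m \<noteq> -1"
        by (metis norm_one norm_power order_less_irrefl, metis norm_minus_cancel norm_one norm_power order_less_irrefl)
      then have "cmod (1 - q z ^ m) \<noteq> 0" "cmod (1 + q z ^ m) \<noteq> 0"
        by (auto simp: add_eq_0_iff)
      then have "ln (cmod (1 - q z ^ m)) + ln (cmod (1 + q z ^ m)) =
          ln (cmod (1 - q z ^ m) * cmod (1 + q z ^ m))"
        by (subst ln_mult) auto
      also have "cmod (1 - q z ^ m) * cmod (1 + q z ^ m) = cmod (1 - q z ^ (2 * m))"
        by (simp add: norm_mult[symmetric] algebra_simps power_mult power2_eq_square mult_2 power_add)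
      finally show "ln (cmod (1 - q z ^ m)) + ln (cmod (1 + q z ^ m)) = ln (cmod (1 - q z ^ (2 * m)))" .
    qed
    finally show ?thesis by simp
  qed
  have J: "J 1 = J (2 ^ k) / 2 ^ k" for k
  proof (induction k)
    case (Suc k)
    then show ?case using step[of "2 ^ k"] by simp
  qed simp
  have "\<bar>J 1\<bar> \<le> (C * measure M UNIV) * (1 / 2) ^ k" for k
  proof -
    have sp: "space M = UNIV" using sets_eq_imp_space_eq[OF \<open>sets M = sets borel\<close>] by simp
    have "\<bar>J (2 ^ k)\<bar> \<le> (LINT z|M. \<bar>ln (cmod (1 - q z ^ (2 ^ k)))\<bar>)"
      unfolding J_def by (rule integral_abs_bound)
    also have "\<dots> \<le> (LINT z|M. C)"
      by (rule integral_mono) (use int[of "2 ^ k" 1] bnd[of "2 ^ k" 1] in auto)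
    finally show ?thesis by (subst J[of k]) (simp add: sp power_one_over field_simps)
  qed
  moreover have "(\<lambda>k. (C * measure M UNIV) * (1 / 2) ^ k) \<longlonglongrightarrow> 0"
    by (auto intro!: tendsto_eq_intros LIMSEQ_realpow_zero)
  ultimately have "\<bar>J 1\<bar> \<le> 0"
    by (intro LIMSEQ_le_const) auto
  then show ?thesis by (simp add: J_def)
qed

text \<open>Jensen's formula, averaged over radii. Since \<open>ln 2\<close> bounds the integrand from above,
  monotone convergence yields integrability together with the value.\<close>

lemma has_bochner_integral_Jensen:
  fixes M :: "complex measure" and a :: complex
  assumes M: "rotation_invariant M" "finite_measure M"
    and ae: "AE z in M. cmod z \<noteq> cmod a"
  shows "has_bochner_integral M (\<lambda>z. ln (cmod (z - a)) - ln (max (cmod z) (cmod a))) 0"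
proof -
  interpret finite_measure M by fact
  have [measurable_cong]: "sets M = sets borel" using M by (auto simp: rotation_invariant_def)
  have sp: "space M = UNIV" using sets_eq_imp_space_eq[OF \<open>sets M = sets borel\<close>] by simp
  \<comment> \<open>The quotient of the smaller by the larger of \<open>z\<close> and
    \<open>a\<close>: the integrand becomes \<open>ln (cmod (1 - q z))\<close>. A rotation of
    \<open>z\<close> by \<open>c\<close> multiplies \<open>q\<close> by \<open>c\<close> or by its
    inverse, according to which of the two is smaller.\<close>
  define q where "q z = (if cmod z < cmod a then z / a else a / z)" for z
  have [measurable]: "q \<in> borel_measurable borel" unfolding q_def by measurable
  have qc: "q (c * z) = c * q z \<or> q (c * z) = q z / c" if "cmod c = 1" for c z
    using that by (auto simp: q_def norm_mult)
  define \<rho> where "\<rho> n = 1 - 1 / (real n + 2)" for n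
  have \<rho>: "0 \<le> \<rho> n" "\<rho> n < 1" for n by (auto simp: \<rho>_def field_simps)
  have \<rho>_mono: "\<rho> m \<le> \<rho> n" if "m \<le> n" for m n
    using that by (auto simp: \<rho>_def field_simps)
  have \<rho>_lim: "\<rho> \<longlonglongrightarrow> 1" unfolding \<rho>_def by real_asymp
  \<comment> \<open>On \<open>A n\<close> the quotient stays away from the unit circle, and the sets
    \<open>A n\<close> exhaust everything off the circle \<open>cmod z = cmod a\<close>.\<close>
  define A where "A n = {z. cmod (q z) \<le> \<rho> n}" for n
  have [measurable]: "A n \<in> sets borel" for n unfolding A_def by measurable
  define k where "k z = ln (cmod (1 - q z))" for z
  have [measurable]: "k \<in> borel_measurable borel" unfolding k_def by measurable
  have k_eq: "ln (cmod (z - a)) - ln (max (cmod z) (cmod a)) = k z"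
    and q_less: "cmod (q z) < 1" if "cmod z \<noteq> cmod a" for z
  proof -
    have "z \<noteq> a" using that by auto
    show "cmod (q z) < 1" using that by (auto simp: q_def norm_divide divide_less_eq_1)
    show "ln (cmod (z - a)) - ln (max (cmod z) (cmod a)) = k z"
    proof (cases "cmod z < cmod a")
      case True
      then have a: "a \<noteq> 0" by auto
      then have "1 - z / a = (a - z) / a" by (simp add: field_simps)
      then have "cmod (1 - q z) = cmod (z - a) / cmod a"
        using True by (simp add: q_def norm_divide norm_minus_commute)
      with a \<open>z \<noteq> a\<close> True show ?thesis by (simp add: k_def ln_div max_def)
    next
      case False
      then have z: "z \<noteq> 0" using that by auto
      then have "1 - a / z = (z - a) / z" by (simp add: field_simps)
      then have "cmod (1 - q z) = cmod (z - a) / cmod z"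
        using False by (simp add: q_def norm_divide)
      with z \<open>z \<noteq> a\<close> False that show ?thesis by (simp add: k_def ln_div max_def)
    qed
  qed
  have kA: "integrable M (\<lambda>z. indicator (A n) z * k z)" "(LINT z|M. indicator (A n) z * k z) = 0" for n
  proof -
    \<comment> \<open>Setting \<open>q\<close> to \<open>0\<close> off \<open>A n\<close> makes the
      logarithm vanish there, and the rotation rule survives because \<open>A n\<close> is itself
      invariant under rotations.\<close>
    define qn where "qn z = (if z \<in> A n then q z else 0)" for z
    have eq: "indicator (A n) z * k z = ln (cmod (1 - qn z))" for z
      by (auto simp: qn_def k_def)
    have [measurable]: "qn \<in> borel_measurable borel" unfolding qn_def by measurable
    have qn_le: "cmod (qn z) \<le> \<rho> n" for z using \<rho>[of n] by (auto simp: qn_def A_def)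
    show "(LINT z|M. indicator (A n) z * k z) = 0"
      unfolding eq
    proof (rule integral_ln_norm_one_minus_eq_0[OF M _ \<rho>(2) qn_le])
      fix c z :: complex assume c: "cmod c = 1"
      have "c * z \<in> A n \<longleftrightarrow> z \<in> A n"
        using qc[OF c, of z] c by (auto simp: A_def norm_mult norm_divide)
      then show "qn (c * z) = c * qn z \<or> qn (c * z) = qn z / c"
        using qc[OF c, of z] by (auto simp: qn_def)
    qed measurable
    show "integrable M (\<lambda>z. indicator (A n) z * k z)"
      unfolding eq
      by (rule integrable_const_bound[of _ "- ln (1 - \<rho> n) + ln 2"])
        (use abs_ln_norm_one_minus_le[OF qn_le \<rho>(2)] in auto)
  qed
  \<comment> \<open>This is \<open>ln 2 - k\<close> restricted to \<open>A n\<close>. It increases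
    with \<open>n\<close> because \<open>k \<le> ln 2\<close>, and its integral is
    \<open>ln 2 * measure M (A n)\<close> because \<open>k\<close> has integral \<open>0\<close>
    over \<open>A n\<close>.\<close>
  define f where "f n z = ln 2 * indicator (A n) z - indicator (A n) z * k z" for n z
  have intA: "integrable M (indicator (A n) :: complex \<Rightarrow> real)" for n
    by (rule integrable_const_bound[of _ 1]) auto
  have "has_bochner_integral M (\<lambda>z. ln 2 - k z) (ln 2 * measure M UNIV)"
  proof (rule has_bochner_integral_monotone_convergence[of M f])
    show "integrable M (f n)" for n
      unfolding f_def using kA(1) intA by auto
    have "integral\<^sup>L M (f n) = ln 2 * measure M (A n)" for n
      unfolding f_def using kA intA by simp
    moreover have "(\<lambda>n. measure M (A n)) \<longlonglongrightarrow> measure M (\<Union>n. A n)"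
      using \<rho>_mono by (intro finite_Lim_measure_incseq) (auto simp: incseq_def A_def intro: order_trans)
    moreover have "measure M (\<Union>n. A n) = measure M UNIV"
    proof (rule measure_eq_AE)
      show "AE z in M. z \<in> (\<Union>n. A n) \<longleftrightarrow> z \<in> UNIV"
        using ae
      proof eventually_elim
        case (elim z)
        have "\<forall>\<^sub>F n in sequentially. cmod (q z) < \<rho> n"
          by (rule order_tendstoD(1)[OF \<rho>_lim q_less[OF elim]])
        then obtain n where "cmod (q z) < \<rho> n" by (auto simp: eventually_sequentially)
        then show ?case by (auto simp: A_def intro!: exI[of _ n])
      qed
    qed auto
    ultimately show "(\<lambda>n. integral\<^sup>L M (f n)) \<longlonglongrightarrow> ln 2 * measure M UNIV"
      by (auto intro!: tendsto_intros)
    show "AE z in M. mono (\<lambda>n. f n z)"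
      using ae
    proof eventually_elim
      case (elim z)
      have "cmod (1 - q z) \<le> 2"
        using norm_triangle_ineq4[of 1 "q z"] q_less[OF elim] by simp
      moreover have "cmod (1 - q z) > 0" using q_less[OF elim] by auto
      ultimately have "k z \<le> ln 2" by (simp add: k_def)
      moreover have "indicator (A m) z \<le> (indicator (A n) z :: real)" if "m \<le> n" for m n
        using \<rho>_mono[OF that] by (auto simp: A_def indicator_def)
      ultimately have "(ln 2 - k z) * indicator (A m) z \<le> (ln 2 - k z) * indicator (A n) z" if "m \<le> n" for m n
        using that by (intro mult_left_mono) auto
      then show ?case by (auto simp: mono_def f_def algebra_simps)
    qed
    show "AE z in M. (\<lambda>n. f n z) \<longlonglongrightarrow> ln 2 - k z"
      using ae
    proof eventually_elim
      case (elim z)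
      have "\<forall>\<^sub>F n in sequentially. cmod (q z) < \<rho> n"
        by (rule order_tendstoD(1)[OF \<rho>_lim q_less[OF elim]])
      then have "\<forall>\<^sub>F n in sequentially. f n z = ln 2 - k z"
        by eventually_elim (auto simp: f_def A_def)
      then show ?case by (rule tendsto_eventually)
    qed
  qed auto
  then have *: "has_bochner_integral M (\<lambda>z. ln 2 - (ln 2 - k z)) (ln 2 * measure M UNIV - ln 2 * measure M UNIV)"
    by (intro has_bochner_integral_diff) (auto simp: has_bochner_integral_iff sp)
  have "has_bochner_integral M k 0" using * by simp
  moreover have "AE z in M. ln (cmod (z - a)) - ln (max (cmod z) (cmod a)) = k z"
    using ae by eventually_elim (rule k_eq)
  ultimately show ?thesis
    by (subst has_bochner_integral_cong_AE) auto
qed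

section \<open>The Fubini--Study measure and its Green kernel\<close>

definition FS_density :: "complex \<Rightarrow> real" where
  "FS_density z = 1 / (pi * (1 + (cmod z)\<^sup>2)\<^sup>2)"

definition FS :: "complex measure" where
  "FS = density lborel (\<lambda>z. ennreal (FS_density z))"

lemma FS_density_pos: "0 < FS_density z"
  by (auto simp: FS_density_def intro!: divide_pos_pos mult_pos_pos zero_less_power add_pos_nonneg)

lemma borel_measurable_FS_density [measurable]: "FS_density \<in> borel_measurable borel"
  unfolding FS_density_def by measurable

lemma sets_FS [measurable_cong, simp]: "sets FS = sets borel"
  by (simp add: FS_def)

lemma space_FS [simp]: "space FS = UNIV"
  by (simp add: FS_def)

lemma rotation_invariant_FS: "rotation_invariant FS"
  unfolding FS_def FS_density_def
  by (rule rotation_invariant_density_radial[where g = "\<lambda>x. ennreal (1 / (pi * (1 + x\<^sup>2)\<^sup>2))"]) measurable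

lemma AE_FS_I: "AE z in lborel. P z \<Longrightarrow> AE z in FS. P z"
  unfolding FS_def by (subst AE_density) (auto elim: eventually_mono)

lemma AE_lborel_norm_neq: "AE z in lborel. cmod z \<noteq> r"
proof -
  have "sphere (0::complex) r \<in> null_sets lborel"
    using negligible_sphere[of "0::complex" r]
    by (auto simp: null_sets_completion_iff negligible_iff_null_sets)
  from AE_not_in[OF this] show ?thesis by eventually_elim auto
qed

text \<open>The variable \<open>t\<close> stands for \<open>|z|\<^sup>2\<close>, whose distribution is \<open>dt / (1 + t)\<^sup>2\<close>.\<close>

lemma has_bochner_integral_FS_radial:
  assumes [measurable]: "g \<in> borel_measurable borel"
    and nonneg: "\<And>t. 0 \<le> t \<Longrightarrow> 0 \<le> g t" and x: "0 \<le> x"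
    and int: "(\<integral>\<^sup>+t. ennreal (g t / (1 + t)\<^sup>2) * indicator {0..} t \<partial>lborel) = ennreal x"
  shows "has_bochner_integral FS (\<lambda>z. g ((cmod z)\<^sup>2)) x"
proof (rule has_bochner_integral_nn_integral[OF _ _ x])
  have "(\<integral>\<^sup>+z. ennreal (g ((cmod z)\<^sup>2)) \<partial>FS) =
      (\<integral>\<^sup>+z. ennreal (1 / (pi * (1 + (cmod z)\<^sup>2)\<^sup>2)) * ennreal (g ((cmod z)\<^sup>2)) \<partial>lborel)"
    unfolding FS_def by (subst nn_integral_density) (auto simp: FS_density_def)
  also have "\<dots> = ennreal pi *
      (\<integral>\<^sup>+t. ennreal (1 / (pi * (1 + t)\<^sup>2)) * ennreal (g t) * indicator {0..} t \<partial>lborel)"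
    by (rule nn_integral_complex_radial[where g = "\<lambda>t. ennreal (1 / (pi * (1 + t)\<^sup>2)) * ennreal (g t)"]) measurable
  also have "\<dots> = (\<integral>\<^sup>+t. ennreal pi * (ennreal (1 / (pi * (1 + t)\<^sup>2)) * ennreal (g t) * indicator {0..} t) \<partial>lborel)"
    by (rule nn_integral_cmult[symmetric]) measurable
  also have "\<dots> = (\<integral>\<^sup>+t. ennreal (g t / (1 + t)\<^sup>2) * indicator {0..} t \<partial>lborel)"
    using nonneg by (intro nn_integral_cong) (auto simp: ennreal_mult'[symmetric] indicator_def)
  finally show "(\<integral>\<^sup>+z. ennreal (g ((cmod z)\<^sup>2)) \<partial>FS) = ennreal x" using int by simp
qed (use nonneg in auto)

lemma has_bochner_integral_FS_one: "has_bochner_integral FS (\<lambda>z. 1 :: real) 1"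
proof (rule has_bochner_integral_FS_radial[where g = "\<lambda>_. 1"])
  have "(\<integral>\<^sup>+t. ennreal (1 / (1 + t)\<^sup>2) * indicator {0..} t \<partial>lborel) = ennreal (0 - (- 1 / (1 + 0)))"
  proof (rule nn_integral_FTC_atLeast[where F = "\<lambda>t. - 1 / (1 + t)"])
    show "((\<lambda>t::real. - 1 / (1 + t)) \<longlongrightarrow> 0) at_top" by real_asymp
  qed (auto intro!: derivative_eq_intros simp: power2_eq_square)
  then show "(\<integral>\<^sup>+t. ennreal (1 / (1 + t)\<^sup>2) * indicator {0..} t \<partial>lborel) = ennreal 1" by simp
qed auto

lemma prob_space_FS: "prob_space FS"
proof
  have "emeasure FS (space FS) = (\<integral>\<^sup>+z. ennreal 1 \<partial>FS)" by simp
  also have "\<dots> = ennreal 1"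
    using has_bochner_integral_FS_one by (subst nn_integral_eq_integral) (auto simp: has_bochner_integral_iff)
  finally show "emeasure FS (space FS) = 1" by simp
qed

interpretation FS: prob_space FS by (rule prob_space_FS)

section \<open>The chordal kernel and its mean against the Fubini--Study measure\<close>

definition log_weight :: "complex \<Rightarrow> real" where
  "log_weight z = ln (1 + (cmod z)\<^sup>2) / 2"

lemma log_weight_nonneg: "0 \<le> log_weight z"
  by (simp add: log_weight_def)

lemma borel_measurable_log_weight [measurable]: "log_weight \<in> borel_measurable borel"
  unfolding log_weight_def by measurable

text \<open>Minus the logarithm of the chordal distance on the Riemann sphere, scaled to have
  diameter one. \<open>log_weight z\<close> is the logarithm of the Euclidean norm of the vector
  \<open>(1, z)\<close>. On the diagonal the value is finite by the convention
  \<open>ln 0 = 0\<close>, which affects only a null set.\<close>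

definition green :: "complex \<Rightarrow> complex \<Rightarrow> real" where
  "green z a = log_weight z + log_weight a - ln (cmod (z - a))"

lemma borel_measurable_green [measurable (raw)]:
  assumes [measurable]: "f \<in> borel_measurable M" "g \<in> borel_measurable M"
  shows "(\<lambda>x. green (f x) (g x)) \<in> borel_measurable M"
  unfolding green_def by measurable

text \<open>On the diagonal this holds because \<open>ln 0 = 0\<close>.\<close>

lemma green_nonneg: "0 \<le> green z a"
proof (cases "z = a")
  case True
  then show ?thesis by (simp add: green_def log_weight_nonneg)
next
  case False
  have "cmod (z - a) \<le> sqrt ((1 + (cmod z)\<^sup>2) * (1 + (cmod a)\<^sup>2))"
  proof (rule real_le_rsqrt)
    have "(cmod (z - a))\<^sup>2 \<le> (cmod z + cmod a)\<^sup>2"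
      by (intro power_mono norm_triangle_ineq4) auto
    \<comment> \<open>The difference of the two sides is
      \<open>(1 - cmod z * cmod a)\<^sup>2\<close>.\<close>
    also have "\<dots> \<le> (1 + (cmod z)\<^sup>2) * (1 + (cmod a)\<^sup>2)"
      using zero_le_power2[of "1 - cmod z * cmod a"]
      by (simp add: power2_eq_square algebra_simps)
    finally show "(cmod (z - a))\<^sup>2 \<le> (1 + (cmod z)\<^sup>2) * (1 + (cmod a)\<^sup>2)" .
  qed
  then have "ln (cmod (z - a)) \<le> ln (sqrt ((1 + (cmod z)\<^sup>2) * (1 + (cmod a)\<^sup>2)))"
    using False by (subst ln_le_cancel_iff) (auto intro!: mult_pos_pos add_pos_nonneg)
  also have "\<dots> = log_weight z + log_weight a"
  proof -
    have "0 < 1 + (cmod z)\<^sup>2" "0 < 1 + (cmod a)\<^sup>2" by (auto intro: add_pos_nonneg)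
    then show ?thesis by (simp add: ln_sqrt log_weight_def ln_mult add_divide_distrib)
  qed
  finally show ?thesis by (simp add: green_def)
qed

text \<open>Antiderivative for the radial integral over \<open>t \<le> s\<close> with
  \<open>s = (cmod a)\<^sup>2\<close>, where the maximum is \<open>s\<close>; there \<open>c\<close>
  is \<open>ln (1 + s) - ln s\<close>.\<close>

lemma DERIV_neg_ln_over:
  fixes t c :: real
  assumes "0 \<le> t"
  shows "((\<lambda>t. - (ln (1 + t) + 1 + c) / (2 * (1 + t))) has_field_derivative
    (ln (1 + t) + c) / 2 / (1 + t)\<^sup>2) (at t within A)"
proof -
  have w: "0 < 1 + t" using assms by simp
  have "(- (1 / w) * (2 * w) - - (ln w + 1 + c) * 2) / (2 * w * (2 * w)) = (ln w + c) / 2 / w\<^sup>2"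
    if "0 < w" for w :: real
    using that by (simp add: field_simps power2_eq_square)
  from this[OF w] show ?thesis
    using w by (auto intro!: derivative_eq_intros)
qed

text \<open>Antiderivative for the radial integral over \<open>t > s\<close>, where the maximum is
  \<open>t\<close>; there \<open>c\<close> is \<open>ln (1 + s)\<close>. Working at
  \<open>w - 1\<close> makes the denominator a power of the variable \<open>w\<close>.\<close>

lemma DERIV_green_radial:
  fixes w c :: real
  assumes "1 < w"
  shows "DERIV (\<lambda>t. - (ln (1 + t) + 1 + t * ln t + c) / (2 * (1 + t)) + ln (1 + t) / 2) (w - 1)
    :> (ln w + c - ln (w - 1)) / 2 / w\<^sup>2"
proof -
  have "(w - 1) * (1 / (w - 1)) = 1" using assms by simp
  with assms show ?thesis
    by (auto intro!: derivative_eq_intros simp: power2_eq_square) (simp add: field_simps)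
qed

text \<open>The integrand depends only on \<open>t = (cmod z)\<^sup>2\<close>. The integral against
  \<open>dt / (1 + t)\<^sup>2\<close> is split at \<open>s = (cmod a)\<^sup>2\<close>; both pieces
  have elementary antiderivatives, and in their sum every trace of \<open>a\<close> cancels.\<close>

lemma has_bochner_integral_FS_green_radial:
  "has_bochner_integral FS
    (\<lambda>z. log_weight z + log_weight a - ln (max (cmod z) (cmod a))) (1 / 2)"
proof -
  define s where "s = (cmod a)\<^sup>2"
  have s: "0 \<le> s" by (simp add: s_def)
  define K where "K t = (ln (1 + t) + ln (1 + s) - ln (max t s)) / 2" for t
  have [measurable]: "K \<in> borel_measurable borel" unfolding K_def by measurable
  have K_nonneg: "0 \<le> K t" if "0 \<le> t" for t
  proof -
    have "ln (max t s) \<le> ln (1 + max t s)" 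
      using that s by (cases "max t s = 0") auto
    also have "\<dots> \<le> ln (1 + t) + ln (1 + s)"
      using that s by (auto simp: max_def)
    finally show ?thesis by (simp add: K_def)
  qed
  \<comment> \<open>\<open>l\<close> and \<open>u\<close> are the integrals over
    \<open>{0..s}\<close> and \<open>{s<..}\<close>, read off from the two antiderivatives; the
    second of these tends to \<open>0\<close> at infinity.\<close>
  define l where "l = - (2 * ln (1 + s) + 1 - ln s) / (2 * (1 + s)) + (1 + ln (1 + s) - ln s) / 2"
  define u where "u = (ln (1 + s) + 1 + s * ln s + ln (1 + s)) / (2 * (1 + s)) - ln (1 + s) / 2"
  have lower: "(\<integral>\<^sup>+t. ennreal (K t / (1 + t)\<^sup>2) * indicator {0..s} t \<partial>lborel) = ennreal l" "0 \<le> l"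
  proof -
    let ?h = "\<lambda>t. (ln (1 + t) + (ln (1 + s) - ln s)) / 2 / (1 + t)\<^sup>2"
    let ?F = "\<lambda>t. - (ln (1 + t) + 1 + (ln (1 + s) - ln s)) / (2 * (1 + t))"
    have h: "0 \<le> ?h t" "K t / (1 + t)\<^sup>2 = ?h t" if "t \<in> {0..s}" for t
      using K_nonneg[of t] that by (auto simp: K_def max_def algebra_simps)
    have l: "l = ?F s - ?F 0" by (simp add: l_def diff_divide_distrib add_divide_distrib)
    have "(\<integral>\<^sup>+t. ennreal (K t / (1 + t)\<^sup>2) * indicator {0..s} t \<partial>lborel) =
        (\<integral>\<^sup>+t. ennreal (?h t) * indicator {0..s} t \<partial>lborel)"
      using h by (intro nn_integral_cong) (auto simp: indicator_def)
    also have "\<dots> = ennreal (?F s - ?F 0)"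
      by (rule nn_integral_FTC_Icc[OF _ DERIV_neg_ln_over h(1) s]) auto
    finally show "(\<integral>\<^sup>+t. ennreal (K t / (1 + t)\<^sup>2) * indicator {0..s} t \<partial>lborel) = ennreal l"
      by (simp add: l)
    have "(LINT t|lborel. ?h t * indicator {0..s} t) = ?F s - ?F 0"
      by (rule integral_FTC_Icc_nonneg[OF _ DERIV_neg_ln_over h(1) s]) auto
    moreover have "0 \<le> (LINT t|lborel. ?h t * indicator {0..s} t)"
      using h(1) by (intro Bochner_Integration.integral_nonneg) (auto simp: indicator_def)
    ultimately show "0 \<le> l" unfolding l by linarith
  qed
  have upper: "(\<integral>\<^sup>+t. ennreal (K t / (1 + t)\<^sup>2) * indicator {s<..} t \<partial>lborel) = ennreal u" "0 \<le> u"
  proof -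
    let ?F = "\<lambda>t. - (ln (1 + t) + 1 + t * ln t + ln (1 + s)) / (2 * (1 + t)) + ln (1 + t) / 2"
    let ?h = "\<lambda>t. (ln (1 + t) + ln (1 + s) - ln t) / 2 / (1 + t)\<^sup>2"
    have ev: "?h t \<ge> 0" if "s < t" for t
      using K_nonneg[of t] that s by (auto simp: K_def max_def)
    have F0: "(?F \<longlongrightarrow> ?F s) (at_right s)"
    \<comment> \<open>At \<open>s = 0\<close> continuity of the logarithm fails, and the limit rests
      on \<open>t * ln t\<close> tending to \<open>0\<close>.\<close>
    proof (cases "s = 0")
      case True
      show ?thesis unfolding True by simp real_asymp
    next
      case False
      with s show ?thesis by (intro tendsto_intros) auto
    qed
    have F1: "(?F \<longlongrightarrow> 0) at_top" by real_asymp
    have D: "DERIV ?F t :> ?h t" and C: "isCont ?h t" if "ereal s < ereal t" for t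
    proof -
      have "0 < t" using that s by simp
      then show "DERIV ?F t :> ?h t"
        using DERIV_green_radial[of "1 + t" "ln (1 + s)"] by simp
      show "isCont ?h t" using \<open>0 < t\<close> by (auto intro!: continuous_intros)
    qed
    have h0: "AE t in lborel. ereal s < ereal t \<longrightarrow> ereal t < \<infinity> \<longrightarrow> 0 \<le> ?h t"
      using ev by auto
    have F0': "((?F \<circ> real_of_ereal) \<longlongrightarrow> ?F s) (at_right (ereal s))"
      using F0 by (simp only: ereal_tendsto_simps)
    have F1': "((?F \<circ> real_of_ereal) \<longlongrightarrow> 0) (at_left \<infinity>)"
      using F1 by (simp only: ereal_tendsto_simps)
    \<comment> \<open>For a nonnegative integrand this form of the fundamental theorem yields both
      integrability and the value, and asks only for one-sided limits at the ends. The interval is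
      open at \<open>s\<close> because the antiderivative need not be differentiable at
      \<open>s = 0\<close>.\<close>
    note FTC = interval_integral_FTC_nonneg[where F = ?F and a = "ereal s" and b = \<infinity> and f = ?h,
        OF _ D C h0 F0' F1']
    have einterval: "einterval (ereal s) \<infinity> = {s<..}" by (auto simp: einterval_def)
    have int: "integrable lborel (\<lambda>t. indicator {s<..} t *\<^sub>R ?h t)"
      using FTC(1) by (simp add: set_integrable_def einterval)
    have val: "(LINT t|lborel. indicator {s<..} t *\<^sub>R ?h t) = 0 - ?F s"
      using FTC(2) by (simp add: interval_lebesgue_integral_def set_lebesgue_integral_def einterval)
    have "(\<integral>\<^sup>+t. ennreal (K t / (1 + t)\<^sup>2) * indicator {s<..} t \<partial>lborel) =
        (\<integral>\<^sup>+t. ennreal (indicator {s<..} t *\<^sub>R ?h t) \<partial>lborel)"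
      using s by (intro nn_integral_cong) (auto simp: K_def indicator_def max_def)
    also have "\<dots> = ennreal (0 - ?F s)"
      unfolding val[symmetric] using ev
      by (intro nn_integral_eq_integral int) (auto simp: indicator_def)
    also have u: "0 - ?F s = u"
      unfolding u_def by (subst minus_divide_left[symmetric]) simp
    finally show "(\<integral>\<^sup>+t. ennreal (K t / (1 + t)\<^sup>2) * indicator {s<..} t \<partial>lborel) = ennreal u" .
    show "0 \<le> u" unfolding u[symmetric] val[symmetric]
      using ev by (intro Bochner_Integration.integral_nonneg) (auto simp: indicator_def)
  qed
  have "(\<integral>\<^sup>+t. ennreal (K t / (1 + t)\<^sup>2) * indicator {0..} t \<partial>lborel) =
      (\<integral>\<^sup>+t. ennreal (K t / (1 + t)\<^sup>2) * indicator {0..s} t + ennreal (K t / (1 + t)\<^sup>2) * indicator {s<..} t \<partial>lborel)"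
    using s by (intro nn_integral_cong) (auto simp: indicator_def)
  also have "\<dots> = (\<integral>\<^sup>+t. ennreal (K t / (1 + t)\<^sup>2) * indicator {0..s} t \<partial>lborel) +
      (\<integral>\<^sup>+t. ennreal (K t / (1 + t)\<^sup>2) * indicator {s<..} t \<partial>lborel)"
    by (rule nn_integral_add) measurable
  also have "\<dots> = ennreal (1 / 2)"
  proof -
    \<comment> \<open>The identity \<open>l + u = 1 / 2\<close> with \<open>W = 1 + s\<close>,
      \<open>L = ln (1 + s)\<close> and \<open>x = ln s\<close> as independent quantities.\<close>
    have "- (2 * L + 1 - x) / (2 * W) + (1 + L - x) / 2 + ((L + 1 + (W - 1) * x + L) / (2 * W) - L / 2) = 1 / 2"
      if "0 < W" for L x W :: real
      using that by (simp add: field_simps)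
    from this[of "1 + s" "ln (1 + s)" "ln s"] have "l + u = 1 / 2"
      using s by (simp add: l_def u_def)
    then have "ennreal (1 / 2) = ennreal l + ennreal u"
      using lower(2) upper(2) by (metis ennreal_plus)
    then show ?thesis by (simp only: lower(1) upper(1))
  qed
  finally have "has_bochner_integral FS (\<lambda>z. K ((cmod z)\<^sup>2)) (1 / 2)"
    using K_nonneg by (intro has_bochner_integral_FS_radial) auto
  moreover have "K ((cmod z)\<^sup>2) = log_weight z + log_weight a - ln (max (cmod z) (cmod a))" for z
  proof -
    have "max ((cmod z)\<^sup>2) s = (max (cmod z) (cmod a))\<^sup>2"
      unfolding s_def by (auto simp: max_def power2_le_iff_abs_le abs_le_square_iff[symmetric])
    moreover have "ln ((max (cmod z) (cmod a))\<^sup>2) = 2 * ln (max (cmod z) (cmod a))"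
      by (cases "max (cmod z) (cmod a) = 0") (auto simp: ln_realpow less_max_iff_disj max_def split: if_splits)
    ultimately show ?thesis by (simp add: K_def log_weight_def s_def diff_divide_distrib add_divide_distrib)
  qed
  ultimately show ?thesis by simp
qed

text \<open>By Jensen's formula \<open>ln (cmod (z - a))\<close> may be replaced by
  \<open>ln (max (cmod z) (cmod a))\<close> under the integral, which reduces the claim to the
  radial computation.\<close>

lemma has_bochner_integral_FS_green: "has_bochner_integral FS (\<lambda>z. green z a) (1 / 2)"
proof -
  have "has_bochner_integral FS (\<lambda>z. ln (cmod (z - a)) - ln (max (cmod z) (cmod a))) 0"
    by (intro has_bochner_integral_Jensen rotation_invariant_FS AE_FS_I AE_lborel_norm_neq)
      unfold_locales
  from has_bochner_integral_diff[OF has_bochner_integral_FS_green_radial[of a] this]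
  show ?thesis by (simp add: green_def algebra_simps)
qed

section \<open>Heights and the averaged Green kernel\<close>

text \<open>Each term is at most \<open>B * x k\<close> in modulus. The squares of the
  \<open>x k\<close> sum to \<open>(1 + (cmod z)\<^sup>2) ^ n\<close> by the binomial theorem, and
  Cauchy--Schwarz over \<open>n + 1\<close> terms costs the factor
  \<open>sqrt (n + 1)\<close>.\<close>

lemma cmod_poly_le:
  fixes p :: "complex poly"
  defines "n \<equiv> degree p"
  defines "B \<equiv> Max ((\<lambda>k. cmod (coeff p k) / sqrt (real (n choose k))) ` {0..n})"
  shows "cmod (poly p z) \<le> B * sqrt (real n + 1) * sqrt ((1 + (cmod z)\<^sup>2) ^ n)"
proof -
  define x where "x k = sqrt (real (n choose k)) * cmod z ^ k" for k
  have coeff: "cmod (coeff p k) \<le> B * sqrt (real (n choose k))" if "k \<le> n" for k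
  proof -
    have "cmod (coeff p k) / sqrt (real (n choose k)) \<le> B"
      unfolding B_def by (rule Max_ge) (use that in auto)
    moreover have "0 < sqrt (real (n choose k))" using that by simp
    ultimately show ?thesis by (simp add: pos_divide_le_eq)
  qed
  have B: "0 \<le> B"
    using coeff[of n] order_trans[OF norm_ge_zero, of "coeff p n" "B * sqrt (real (n choose n))"] by simp
  have "(\<Sum>k\<le>n. x k)\<^sup>2 \<le> (\<Sum>k\<le>n. (x k)\<^sup>2) * real (card {..n})"
    using sum_squared_le_sum_of_squares[of x "{..n}"] by (simp add: mult.commute)
  also have "(\<Sum>k\<le>n. (x k)\<^sup>2) = ((cmod z)\<^sup>2 + 1) ^ n"
    by (subst binomial_ring) (simp add: x_def power_mult_distrib power_mult[symmetric] mult.commute)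
  finally have "(\<Sum>k\<le>n. x k) \<le> sqrt (((cmod z)\<^sup>2 + 1) ^ n * real (card {..n}))"
    by (rule real_le_rsqrt)
  then have x: "(\<Sum>k\<le>n. x k) \<le> sqrt (real n + 1) * sqrt ((1 + (cmod z)\<^sup>2) ^ n)"
    by (simp add: real_sqrt_mult[symmetric] ac_simps)
  have "cmod (poly p z) \<le> (\<Sum>k\<le>n. cmod (coeff p k * z ^ k))"
    unfolding poly_altdef n_def by (rule norm_sum)
  also have "\<dots> \<le> (\<Sum>k\<le>n. B * x k)"
  proof (rule sum_mono)
    fix k assume "k \<in> {..n}"
    then have "cmod (coeff p k) * cmod z ^ k \<le> (B * sqrt (real (n choose k))) * cmod z ^ k"
      using coeff by (intro mult_right_mono) auto
    then show "cmod (coeff p k * z ^ k) \<le> B * x k"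
      by (simp add: x_def norm_mult norm_power mult.assoc)
  qed
  also have "\<dots> = B * (\<Sum>k\<le>n. x k)" by (simp add: sum_distrib_left)
  also have "\<dots> \<le> B * (sqrt (real n + 1) * sqrt ((1 + (cmod z)\<^sup>2) ^ n))"
    using x B by (rule mult_left_mono)
  finally show ?thesis by (simp add: mult.assoc)
qed

text \<open>The logarithm of \<open>cmod_poly_le\<close>, divided by \<open>n\<close>: the factor
  \<open>sqrt (n + 1)\<close> turns into an error term that vanishes in the limit.\<close>

lemma ln_cmod_poly_le_h_B:
  fixes p :: "complex poly" and n :: nat
  assumes n: "degree p = n" "n \<ge> 1" and z: "poly p z \<noteq> 0"
  shows "ln (cmod (poly p z)) / n \<le> h_B p + ln (real n + 1) / (2 * n) + log_weight z"
proof -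
  define B where "B = Max ((\<lambda>k. cmod (coeff p k) / sqrt (real (n choose k))) ` {0..n})"
  have le: "cmod (poly p z) \<le> B * sqrt (real n + 1) * sqrt ((1 + (cmod z)\<^sup>2) ^ n)"
    using cmod_poly_le[of p z] n by (simp add: B_def)
  have "cmod (coeff p n) / sqrt (real (n choose n)) \<le> B"
    unfolding B_def by (intro Max_ge imageI) auto
  moreover have "0 < cmod (coeff p n)" using n by (auto simp: leading_coeff_0_iff)
  \<comment> \<open>The leading coefficient alone makes the maximum positive, so that its logarithm
    splits off.\<close>
  ultimately have B: "0 < B" by (simp del: zero_less_norm_iff)
  have w: "0 < 1 + (cmod z)\<^sup>2" by (simp add: add_pos_nonneg)
  have "ln (cmod (poly p z)) \<le> ln (B * sqrt (real n + 1) * sqrt ((1 + (cmod z)\<^sup>2) ^ n))"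
    using le z B w by (subst ln_le_cancel_iff) auto
  also have "\<dots> = ln B + ln (real n + 1) / 2 + n * ln (1 + (cmod z)\<^sup>2) / 2"
    using B w by (simp add: ln_mult ln_sqrt ln_realpow)
  finally have "ln (cmod (poly p z)) / n \<le> (ln B + ln (real n + 1) / 2 + n * ln (1 + (cmod z)\<^sup>2) / 2) / n"
    by (rule divide_right_mono) simp
  also have "\<dots> = h_B p + ln (real n + 1) / (2 * n) + log_weight z"
    using n by (simp add: h_B_def B_def log_weight_def add_divide_distrib)
  finally show ?thesis .
qed

section \<open>Factorisation over the zeros\<close>

lemma complex_poly_roots_enum:
  fixes p :: "complex poly"
  obtains r where "proots p = image_mset r (mset_set {..<degree p})"
proof -
  obtain xs where xs: "mset xs = proots p" using ex_mset by blast
  have len: "length xs = degree p"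
    by (metis size_mset size_proots_complex xs)
  have "proots p = mset (map ((!) xs) [0..<degree p])"
    by (simp add: xs[symmetric] len[symmetric] map_nth del: mset_map)
  then show ?thesis using that[of "(!) xs"] by (simp add: atLeast0LessThan)
qed

lemma poly_eq_prod_roots:
  fixes p :: "complex poly"
  assumes r: "proots p = image_mset r (mset_set {..<degree p})"
  shows "poly p z = lead_coeff p * (\<Prod>i<degree p. z - r i)"
proof -
  have "poly p z = lead_coeff p * poly (\<Prod>x\<in>#proots p. [:-x, 1:]) z"
    by (subst complex_poly_decompose_multiset[of p, symmetric]) (simp only: poly_smult)
  also have "poly (\<Prod>x\<in>#proots p. [:-x, 1:]) z = (\<Prod>i<degree p. z - r i)"
    unfolding poly_prod_mset r by (simp add: prod_unfold_prod_mset image_mset.compositionality comp_def)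
  finally show ?thesis .
qed

text \<open>Factorisation turns \<open>ln (cmod (poly p z))\<close> into a sum over the zeros. The
  weights of the zeros together with the leading coefficient make up exactly
  \<open>h_FS p\<close>.\<close>

lemma average_green_eq:
  fixes p :: "complex poly" and n :: nat and r :: "nat \<Rightarrow> complex"
  assumes r: "proots p = image_mset r (mset_set {..<n})"
    and n: "degree p = n" "n \<ge> 1" and z: "poly p z \<noteq> 0"
  shows "(\<Sum>i<n. green z (r i)) / n = h_FS p + log_weight z - ln (cmod (poly p z)) / n"
proof -
  have p: "poly p z = lead_coeff p * (\<Prod>i<n. z - r i)"
    using poly_eq_prod_roots[of p r z] r n by simp
  with z have nz: "lead_coeff p \<noteq> 0" "\<And>i. i < n \<Longrightarrow> z - r i \<noteq> 0" by auto
  have "ln (cmod (poly p z)) = ln (cmod (lead_coeff p)) + ln (\<Prod>i<n. cmod (z - r i))"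
    using nz by (simp add: p norm_mult prod_norm[symmetric] ln_mult prod_pos)
  also have "ln (\<Prod>i<n. cmod (z - r i)) = (\<Sum>i<n. ln (cmod (z - r i)))"
    using nz by (intro ln_prod) auto
  finally have ln: "ln (cmod (poly p z)) = ln (cmod (lead_coeff p)) + (\<Sum>i<n. ln (cmod (z - r i)))" .
  have "h_FS p = ln (cmod (lead_coeff p)) / n + (\<Sum>i<n. log_weight (r i)) / n"
    unfolding h_FS_def r n(1)
    by (simp add: image_mset.compositionality comp_def sum_unfold_sum_mset[symmetric] log_weight_def
        sum_divide_distrib[symmetric])
  moreover have "(\<Sum>i<n. green z (r i)) =
      n * log_weight z + (\<Sum>i<n. log_weight (r i)) - (\<Sum>i<n. ln (cmod (z - r i)))"
    by (simp add: green_def sum.distrib sum_subtractf)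
  ultimately show ?thesis using n
    by (simp add: ln add_divide_distrib diff_divide_distrib)
qed

lemma has_bochner_integral_average_green:
  fixes n :: nat and r :: "nat \<Rightarrow> complex"
  assumes "n \<ge> 1"
  shows "has_bochner_integral FS (\<lambda>z. (\<Sum>i<n. green z (r i)) / n) (1 / 2)"
proof -
  have "has_bochner_integral FS (\<lambda>z. (\<Sum>i<n. green z (r i)) / n) ((\<Sum>i<n. 1 / 2) / n)"
    by (intro has_bochner_integral_divide_zero has_bochner_integral_sum has_bochner_integral_FS_green)
  with assms show ?thesis by simp
qed

text \<open>A function with mean \<open>1/2\<close> that is nowhere smaller than \<open>1/2 - \<delta>\<close> is within
  \<open>2 * \<delta>\<close> of \<open>1/2\<close> in mean.\<close>

lemma average_green_L1_bound:
  fixes p :: "complex poly" and n :: nat and r :: "nat \<Rightarrow> complex"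
  assumes r: "proots p = image_mset r (mset_set {..<n})"
    and n: "degree p = n" "n \<ge> 1"
  shows "(LINT z|FS. \<bar>(\<Sum>i<n. green z (r i)) / n - 1 / 2\<bar>)
    \<le> 2 * (max 0 (h_B p + 1 / 2 - h_FS p) + ln (real n + 1) / (2 * n))"
proof -
  define w where "w z = (\<Sum>i<n. green z (r i)) / n" for z
  \<comment> \<open>The height difference is controlled from above only; the \<open>max\<close>
    makes \<open>\<delta>\<close> nonnegative.\<close>
  define \<delta> where "\<delta> = max 0 (h_B p + 1 / 2 - h_FS p) + ln (real n + 1) / (2 * n)"
  have \<delta>: "0 \<le> \<delta>" by (simp add: \<delta>_def add_nonneg_nonneg)
  have w: "integrable FS w" "integral\<^sup>L FS w = 1 / 2"
    using has_bochner_integral_average_green[OF n(2), of r] by (auto simp: w_def[abs_def] has_bochner_integral_iff)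
  have "p \<noteq> 0" using n by auto
  then have "finite {z. poly p z = 0}" by (rule poly_roots_finite)
  then have "{z. poly p z = 0} \<in> null_sets lborel"
    by (intro finite_imp_null_set_lborel)
  then have "AE z in lborel. poly p z \<noteq> 0"
    using AE_not_in by fastforce
  then have "AE z in FS. poly p z \<noteq> 0" by (rule AE_FS_I)
  \<comment> \<open>A real \<open>u \<ge> - \<delta>\<close> satisfies
    \<open>\<bar>u\<bar> \<le> u + 2 * \<delta>\<close>; here \<open>u = w z - 1 / 2\<close> has
    integral \<open>0\<close>, so only \<open>2 * \<delta>\<close> survives integration.\<close>
  then have "AE z in FS. \<bar>w z - 1 / 2\<bar> \<le> w z - 1 / 2 + 2 * \<delta>"
  proof eventually_elim
    case (elim z)
    have "w z \<ge> h_FS p - h_B p - ln (real n + 1) / (2 * n)"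
      using average_green_eq[OF r n elim] ln_cmod_poly_le_h_B[OF n elim] by (simp add: w_def)
    then have "w z - 1 / 2 \<ge> - \<delta>" by (simp add: \<delta>_def)
    with \<delta> show ?case by simp
  qed
  then have "(LINT z|FS. \<bar>w z - 1 / 2\<bar>) \<le> (LINT z|FS. w z - 1 / 2 + 2 * \<delta>)"
    using w by (intro integral_mono_AE) auto
  also have "\<dots> = 2 * \<delta>" using w by (simp add: FS.prob_space[simplified])
  finally show ?thesis by (simp add: w_def \<delta>_def)
qed

section \<open>Equidistribution tested on potentials\<close>

text \<open>\<open>\<alpha> n i\<close> for \<open>i < n\<close> are the points of the
  \<open>n\<close>-th configuration. The value type is left open so that real potentials and complex
  test functions share one notion.\<close>

definition equidistributed :: "(nat \<Rightarrow> nat \<Rightarrow> complex) \<Rightarrow> (complex \<Rightarrow> 'b::{banach, second_countable_topology}) \<Rightarrow> bool" where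
  "equidistributed \<alpha> f \<longleftrightarrow> (\<lambda>n. (1 / real n) *\<^sub>R (\<Sum>i<n. f (\<alpha> n i))) \<longlonglongrightarrow> (LINT z|FS. f z)"

text \<open>The density \<open>\<eta>\<close> is taken relative to \<open>FS\<close>, not to
  Lebesgue measure.\<close>

definition green_potential :: "(complex \<Rightarrow> real) \<Rightarrow> complex \<Rightarrow> real" where
  "green_potential \<eta> a = (LINT z|FS. green z a * \<eta> z)"

lemma integrable_green_mult:
  assumes [measurable]: "\<eta> \<in> borel_measurable borel" and bnd: "\<And>z. \<bar>\<eta> z\<bar> \<le> C"
  shows "integrable FS (\<lambda>z. green z a * \<eta> z)"
proof (rule Bochner_Integration.integrable_bound[of _ "\<lambda>z. green z a * C"])
  show "integrable FS (\<lambda>z. green z a * C)"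
    using has_bochner_integral_FS_green[of a] by (auto simp: has_bochner_integral_iff)
  show "AE z in FS. norm (green z a * \<eta> z) \<le> norm (green z a * C)"
  proof (intro AE_I2)
    fix z
    have "\<bar>\<eta> z\<bar> \<le> \<bar>C\<bar>" using bnd[of z] by linarith
    then show "norm (green z a * \<eta> z) \<le> norm (green z a * C)"
      by (simp add: abs_mult mult_left_mono)
  qed
qed measurable

lemma green_commute: "green z a = green a z"
  by (simp add: green_def norm_minus_commute)

interpretation FS_pair: pair_sigma_finite FS FS ..

text \<open>By Fubini the integration over \<open>a\<close> can be done first, and by symmetry of
  the kernel it contributes the constant \<open>1 / 2\<close>.\<close>

lemma has_bochner_integral_green_potential:
  assumes [measurable]: "\<eta> \<in> borel_measurable borel" and bnd: "\<And>z. \<bar>\<eta> z\<bar> \<le> C"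
  shows "has_bochner_integral FS (green_potential \<eta>) ((LINT z|FS. \<eta> z) / 2)"
proof -
  have g: "integrable FS (green z)" "integral\<^sup>L FS (green z) = 1 / 2" for z
    using has_bochner_integral_FS_green[of z] green_commute[of _ z]
    by (auto simp: has_bochner_integral_iff)
  have *: "integrable (FS \<Otimes>\<^sub>M FS) (\<lambda>(z, a). green z a * \<eta> z)"
  proof (rule FS_pair.Fubini_integrable)
    have eq: "(LINT a|FS. norm (green z a * \<eta> z)) = \<bar>\<eta> z\<bar> / 2" for z
      using g[of z] by (simp add: abs_mult green_nonneg)
    moreover have "integrable FS (\<lambda>z. \<bar>\<eta> z\<bar> / 2)"
      by (rule FS.integrable_const_bound[of _ "C / 2"]) (use bnd in auto)
    ultimately show "integrable FS (\<lambda>z. LINT a|FS. norm (case (z, a) of (z, a) \<Rightarrow> green z a * \<eta> z))"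
      by (simp only: prod.case eq)
  qed (use g in auto)
  have "(LINT a|FS. (LINT z|FS. green z a * \<eta> z)) = (LINT z|FS. (LINT a|FS. green z a * \<eta> z))"
    by (rule FS_pair.Fubini_integral[OF *])
  also have "\<dots> = (LINT z|FS. \<eta> z) / 2"
    by (simp only: integral_mult_left_zero g(2)) simp
  finally have "integral\<^sup>L FS (green_potential \<eta>) = (LINT z|FS. \<eta> z) / 2"
    by (simp add: green_potential_def[abs_def])
  moreover have "integrable FS (green_potential \<eta>)"
    unfolding green_potential_def[abs_def]
    using FS_pair.integrable_snd[OF *] by simp
  ultimately show ?thesis by (simp add: has_bochner_integral_iff)
qed

text \<open>The average of the potential over the points is the integral of the averaged kernel
  against \<open>\<eta>\<close>. It differs from half the integral of \<open>\<eta>\<close>, which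
  is the mean of the potential, by at most \<open>C\<close> times the L1 distance of the averaged
  kernel from \<open>1 / 2\<close>.\<close>

lemma equidistributed_green_potential:
  fixes \<alpha> :: "nat \<Rightarrow> nat \<Rightarrow> complex"
  assumes L1: "(\<lambda>n. LINT z|FS. \<bar>(\<Sum>i<n. green z (\<alpha> n i)) / n - 1 / 2\<bar>) \<longlonglongrightarrow> 0"
    and [measurable]: "\<eta> \<in> borel_measurable borel" and bnd: "\<And>z. \<bar>\<eta> z\<bar> \<le> C"
  shows "equidistributed \<alpha> (green_potential \<eta>)"
proof -
  have C: "0 \<le> C" using bnd[of 0] by linarith
  have \<eta>: "integrable FS \<eta>"
    by (rule FS.integrable_const_bound[of _ C]) (use bnd in auto)
  let ?w = "\<lambda>n z. (\<Sum>i<n. green z (\<alpha> n i)) / real n"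
  have "\<forall>\<^sub>F n in sequentially. norm ((1 / real n) *\<^sub>R (\<Sum>i<n. green_potential \<eta> (\<alpha> n i)) - (LINT z|FS. \<eta> z) / 2)
      \<le> C * (LINT z|FS. \<bar>?w n z - 1 / 2\<bar>)"
    using eventually_ge_at_top[of 1]
  proof eventually_elim
    case (elim n)
    have w: "integrable FS (?w n)"
      using has_bochner_integral_average_green[OF elim, of "\<alpha> n"] by (rule has_bochner_integral_iff[THEN iffD1, THEN conjunct1])
    have "(1 / real n) *\<^sub>R (\<Sum>i<n. green_potential \<eta> (\<alpha> n i)) = (LINT z|FS. ?w n z * \<eta> z)"
      unfolding green_potential_def
      by (subst Bochner_Integration.integral_sum[symmetric])
        (use integrable_green_mult[of \<eta> C] bnd in \<open>auto simp: sum_distrib_right\<close>)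
    moreover have wi: "integrable FS (\<lambda>z. ?w n z * \<eta> z)"
      using integrable_green_mult[of \<eta> C] bnd by (auto simp: sum_distrib_right)
    ultimately have "(1 / real n) *\<^sub>R (\<Sum>i<n. green_potential \<eta> (\<alpha> n i)) - (LINT z|FS. \<eta> z) / 2 =
        (LINT z|FS. (?w n z - 1 / 2) * \<eta> z)"
      using \<eta> by (simp add: left_diff_distrib)
    also have "norm \<dots> \<le> (LINT z|FS. norm ((?w n z - 1 / 2) * \<eta> z))"
      by (rule integral_norm_bound)
    also have "\<dots> \<le> (LINT z|FS. C * \<bar>?w n z - 1 / 2\<bar>)"
    proof (rule integral_mono)
      show "integrable FS (\<lambda>z. norm ((?w n z - 1 / 2) * \<eta> z))"
        using wi \<eta> by (auto simp: left_diff_distrib)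
      show "norm ((?w n z - 1 / 2) * \<eta> z) \<le> C * \<bar>?w n z - 1 / 2\<bar>" for z
        using bnd[of z] by (simp add: abs_mult mult.commute mult_right_mono)
    qed (use w in auto)
    finally show ?case by simp
  qed
  then have "(\<lambda>n. (1 / real n) *\<^sub>R (\<Sum>i<n. green_potential \<eta> (\<alpha> n i)) - (LINT z|FS. \<eta> z) / 2) \<longlonglongrightarrow> 0"
    by (rule Lim_null_comparison) (use tendsto_mult_left[OF L1, of C] in simp)
  moreover have "integral\<^sup>L FS (green_potential \<eta>) = (LINT z|FS. \<eta> z) / 2"
    by (rule has_bochner_integral_integral_eq[OF has_bochner_integral_green_potential]) (use bnd in auto)
  ultimately show ?thesis
    unfolding equidistributed_def by (simp only: LIM_zero_iff)
qed

section \<open>Bumps as potentials\<close>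

lemma equidistributed_const: "equidistributed \<alpha> (\<lambda>_. k)"
proof -
  have "\<forall>\<^sub>F n in sequentially. (1 / real n) *\<^sub>R (\<Sum>i<n. k) = (LINT z|FS. k)"
    using eventually_ge_at_top[of 1]
    by eventually_elim (simp add: sum_constant_scaleR FS.prob_space[simplified])
  then show ?thesis unfolding equidistributed_def by (rule tendsto_eventually)
qed

lemma equidistributed_add:
  assumes "equidistributed \<alpha> f" "integrable FS f" "equidistributed \<alpha> g" "integrable FS g"
  shows "equidistributed \<alpha> (\<lambda>z. f z + g z)"
  using tendsto_add[OF assms(1)[unfolded equidistributed_def] assms(3)[unfolded equidistributed_def]] assms(2,4)
  by (simp add: equidistributed_def sum.distrib scaleR_add_right)

lemma equidistributed_diff:
  assumes "equidistributed \<alpha> f" "integrable FS f" "equidistributed \<alpha> g" "integrable FS g"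
  shows "equidistributed \<alpha> (\<lambda>z. f z - g z)"
  using tendsto_diff[OF assms(1)[unfolded equidistributed_def] assms(3)[unfolded equidistributed_def]] assms(2,4)
  by (simp add: equidistributed_def sum_subtractf scaleR_diff_right)

lemma equidistributed_scaleR:
  assumes "equidistributed \<alpha> f"
  shows "equidistributed \<alpha> (\<lambda>z. k *\<^sub>R f z)"
  using tendsto_scaleR[OF tendsto_const[of k] assms[unfolded equidistributed_def]]
  by (simp add: equidistributed_def scaleR_sum_right[symmetric] mult.commute)

text \<open>Point averages and the integral against the probability measure \<open>FS\<close> both
  move by at most the uniform distance when \<open>f\<close> is replaced by
  \<open>g\<close>.\<close>

lemma equidistributed_uniform_closure:
  assumes f: "integrable FS f"
    and approx: "\<And>\<epsilon>. 0 < \<epsilon> \<Longrightarrow>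
      \<exists>g. equidistributed \<alpha> g \<and> integrable FS g \<and> (\<forall>z. norm (f z - g z) \<le> \<epsilon>)"
  shows "equidistributed \<alpha> f"
  unfolding equidistributed_def
proof (rule tendstoI)
  fix r :: real assume r: "0 < r"
  obtain g where g: "equidistributed \<alpha> g" "integrable FS g" "\<And>z. norm (f z - g z) \<le> r / 4"
    using approx[of "r / 4"] r by auto
  have I: "norm ((LINT z|FS. g z) - (LINT z|FS. f z)) \<le> r / 4"
  proof -
    have "norm ((LINT z|FS. g z) - (LINT z|FS. f z)) = norm (LINT z|FS. f z - g z)"
      using f g(2) by (simp add: norm_minus_commute)
    also have "\<dots> \<le> (LINT z|FS. norm (f z - g z))" by (rule integral_norm_bound)
    also have "\<dots> \<le> (LINT z|FS. r / 4)"
      using f g by (intro integral_mono) auto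
    finally show ?thesis by (simp add: FS.prob_space[simplified])
  qed
  have "\<forall>\<^sub>F n in sequentially. dist ((1 / real n) *\<^sub>R (\<Sum>i<n. g (\<alpha> n i))) (LINT z|FS. g z) < r / 4"
    using g(1) r unfolding equidistributed_def by (intro tendstoD) auto
  then show "\<forall>\<^sub>F n in sequentially. dist ((1 / real n) *\<^sub>R (\<Sum>i<n. f (\<alpha> n i))) (LINT z|FS. f z) < r"
    using eventually_ge_at_top[of 1]
  proof eventually_elim
    case (elim n)
    let ?f = "(1 / real n) *\<^sub>R (\<Sum>i<n. f (\<alpha> n i))" and ?g = "(1 / real n) *\<^sub>R (\<Sum>i<n. g (\<alpha> n i))"
    have "norm (\<Sum>i<n. f (\<alpha> n i) - g (\<alpha> n i)) \<le> (\<Sum>i<n. r / 4)"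
      by (rule sum_norm_le) (rule g)
    then have "norm (?f - ?g) \<le> r / 4"
      using elim(2) by (simp add: scaleR_diff_right[symmetric] sum_subtractf[symmetric] divide_le_eq mult.commute)
    moreover have "norm (?g - (LINT z|FS. g z)) < r / 4" using elim(1) by (simp add: dist_norm)
    ultimately have "norm ((?f - ?g) + (?g - (LINT z|FS. g z)) + ((LINT z|FS. g z) - (LINT z|FS. f z))) < r"
      using I r norm_triangle_ineq[of "?f - ?g" "?g - (LINT z|FS. g z)"]
        norm_triangle_ineq[of "(?f - ?g) + (?g - (LINT z|FS. g z))" "(LINT z|FS. g z) - (LINT z|FS. f z)"]
      by linarith
    then show ?case by (simp add: dist_norm)
  qed
qed

section \<open>Uniform distributions on annuli and their potentials\<close>

definition annulus :: "real \<Rightarrow> real \<Rightarrow> complex set" where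
  "annulus r s = {z. r \<le> cmod z \<and> cmod z \<le> s}"

lemma annulus_measurable [measurable]: "annulus r s \<in> sets borel"
  unfolding annulus_def by measurable

lemma measure_annulus_pos:
  assumes "0 < r" "r < s"
  shows "0 < measure lborel (annulus r s)"
proof -
  have "measure lborel (annulus r s) = measure lborel (cball (0::complex) s - ball 0 r)"
    by (rule arg_cong[where f = "measure lborel"]) (auto simp: annulus_def)
  also have "\<dots> = measure lborel (cball (0::complex) s) - measure lborel (ball (0::complex) r)"
  proof (rule measure_Diff)
    show "emeasure lborel (cball (0::complex) s) \<noteq> \<infinity>"
      using emeasure_lborel_cball_finite[of "0::complex" s] by simp
    show "ball (0::complex) r \<subseteq> cball 0 s"
      using assms by (intro subsetI) simp
  qed simp_all
  also have "\<dots> = pi * s\<^sup>2 - pi * r\<^sup>2"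
    using assms by (simp add: content_ball content_cball unit_ball_vol_2)
  also have "\<dots> > 0" using assms by (simp add: power_strict_mono)
  finally show ?thesis .
qed

definition annulus_density :: "real \<Rightarrow> real \<Rightarrow> complex \<Rightarrow> real" where
  "annulus_density r s z = indicator (annulus r s) z / measure lborel (annulus r s)"

lemma annulus_density_measurable [measurable]: "annulus_density r s \<in> borel_measurable borel"
  unfolding annulus_density_def by measurable

lemma annulus_density_nonneg: "0 \<le> annulus_density r s z"
  by (simp add: annulus_density_def)

text \<open>An annulus is used instead of a circle so that the measure has a bounded density, as
  \<open>equidistributed_green_potential\<close> demands.\<close>

definition annulus_measure :: "real \<Rightarrow> real \<Rightarrow> complex measure" where
  "annulus_measure r s = density lborel (\<lambda>z. ennreal (annulus_density r s z))"

lemma sets_annulus_measure [measurable_cong, simp]: "sets (annulus_measure r s) = sets borel"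
  by (simp add: annulus_measure_def)

lemma space_annulus_measure [simp]: "space (annulus_measure r s) = UNIV"
  by (simp add: annulus_measure_def)

lemma rotation_invariant_annulus_measure: "rotation_invariant (annulus_measure r s)"
proof -
  have "annulus_measure r s = density lborel (\<lambda>z. (\<lambda>x. ennreal (indicator {r..s} x / measure lborel (annulus r s))) (cmod z))"
    by (auto simp: annulus_measure_def annulus_density_def annulus_def indicator_def intro!: arg_cong2[where f = density])
  then show ?thesis
    by (simp only:) (rule rotation_invariant_density_radial, measurable)
qed

lemma prob_space_annulus_measure:
  assumes "0 < r" "r < s"
  shows "prob_space (annulus_measure r s)"
proof
  have fin: "emeasure lborel (annulus r s) \<noteq> \<infinity>"
  proof -
    have "emeasure lborel (annulus r s) \<le> emeasure lborel (cball (0::complex) s)"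
      by (intro emeasure_mono) (auto simp: annulus_def)
    also have "\<dots> < \<infinity>" by (rule emeasure_lborel_cball_finite)
    finally show ?thesis by simp
  qed
  define m where "m = measure lborel (annulus r s)"
  have m: "0 < m" unfolding m_def by (rule measure_annulus_pos[OF assms])
  have "emeasure (annulus_measure r s) UNIV = (\<integral>\<^sup>+z. ennreal (annulus_density r s z) \<partial>lborel)"
    unfolding annulus_measure_def by (subst emeasure_density) auto
  also have "\<dots> = (\<integral>\<^sup>+z. ennreal (1 / m) * indicator (annulus r s) z \<partial>lborel)"
    by (intro nn_integral_cong) (auto simp: annulus_density_def m_def indicator_def)
  also have "\<dots> = ennreal (1 / m) * ennreal m"
    using fin by (simp add: nn_integral_cmult m_def emeasure_eq_ennreal_measure)
  also have "\<dots> = 1" using m by (simp add: ennreal_mult'[symmetric])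
  finally show "emeasure (annulus_measure r s) (space (annulus_measure r s)) = 1" by simp
qed

lemma AE_annulus_measure: "AE z in annulus_measure r s. r \<le> cmod z \<and> cmod z \<le> s"
  unfolding annulus_measure_def
  by (subst AE_density) (auto simp: annulus_density_def annulus_def indicator_def)

lemma integral_annulus_measure:
  fixes f :: "complex \<Rightarrow> real"
  assumes [measurable]: "f \<in> borel_measurable borel"
  shows "(LINT z|annulus_measure r s. f z) = (LINT z|lborel. annulus_density r s z * f z)"
  unfolding annulus_measure_def
  by (subst integral_density) (auto simp: annulus_density_nonneg)

text \<open>For \<open>0 < r < s\<close> this is, by Jensen's formula, the mean of
  \<open>ln (cmod (z - b))\<close> over the annulus, written with an integrand free of
  singularities.\<close>

definition log_mean :: "real \<Rightarrow> real \<Rightarrow> complex \<Rightarrow> real" where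
  "log_mean r s b = (LINT z|annulus_measure r s. ln (max (cmod z) (cmod b)))"

text \<open>The integrand lies between its values at the inner and the outer radius, and the total
  mass is one. For \<open>s \<le> cmod b\<close> the two bounds coincide, which is the source of the
  compact support of the bumps.\<close>

lemma log_mean_bounds:
  assumes rs: "0 < r" "r < s"
  shows "integrable (annulus_measure r s) (\<lambda>z. ln (max (cmod z) (cmod b)))"
    and "ln (max r (cmod b)) \<le> log_mean r s b"
    and "log_mean r s b \<le> ln (max s (cmod b))"
proof -
  interpret prob_space "annulus_measure r s" by (rule prob_space_annulus_measure[OF rs])
  have ae: "AE z in annulus_measure r s. ln (max r (cmod b)) \<le> ln (max (cmod z) (cmod b)) \<and>
      ln (max (cmod z) (cmod b)) \<le> ln (max s (cmod b))"
    using AE_annulus_measure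
  proof eventually_elim
    case (elim z)
    then have "0 < max r (cmod b)" "max r (cmod b) \<le> max (cmod z) (cmod b)"
      "max (cmod z) (cmod b) \<le> max s (cmod b)"
      using rs by auto
    then show ?case by (auto intro!: ln_mono simp: less_le_trans)
  qed
  show int: "integrable (annulus_measure r s) (\<lambda>z. ln (max (cmod z) (cmod b)))"
  proof (rule integrable_const_bound)
    show "AE z in annulus_measure r s. norm (ln (max (cmod z) (cmod b))) \<le>
        \<bar>ln (max r (cmod b))\<bar> + \<bar>ln (max s (cmod b))\<bar>"
      using ae by eventually_elim (simp only: real_norm_def, linarith)
  qed measurable
  have "(LINT z|annulus_measure r s. ln (max r (cmod b))) \<le> log_mean r s b"
    unfolding log_mean_def using ae by (intro integral_mono_AE int) auto
  then show "ln (max r (cmod b)) \<le> log_mean r s b" by (simp add: prob_space[simplified])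
  have "log_mean r s b \<le> (LINT z|annulus_measure r s. ln (max s (cmod b)))"
    unfolding log_mean_def using ae by (intro integral_mono_AE int) auto
  then show "log_mean r s b \<le> ln (max s (cmod b))" by (simp add: prob_space[simplified])
qed

text \<open>Since \<open>c + z - a = z - (a - c)\<close>, Jensen's formula applies with
  \<open>a - c\<close> in place of \<open>a\<close>. Besides \<open>log_weight a\<close>, which is
  the same for all annuli, the result depends on \<open>a\<close> only through
  \<open>log_mean\<close>.\<close>

lemma integral_annulus_green:
  assumes rs: "0 < r" "r < s"
  shows "(LINT z|annulus_measure r s. green (c + z) a) =
    (LINT z|annulus_measure r s. log_weight (c + z)) + log_weight a - log_mean r s (a - c)"
proof -
  interpret prob_space "annulus_measure r s" by (rule prob_space_annulus_measure[OF rs])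
  have "AE z in lborel. cmod z \<noteq> cmod (a - c)" by (rule AE_lborel_norm_neq)
  then have "AE z in annulus_measure r s. cmod z \<noteq> cmod (a - c)"
    unfolding annulus_measure_def by (subst AE_density) (auto elim: eventually_mono)
  from has_bochner_integral_Jensen[OF rotation_invariant_annulus_measure _ this]
  have J: "has_bochner_integral (annulus_measure r s)
      (\<lambda>z. ln (cmod (z - (a - c))) - ln (max (cmod z) (cmod (a - c)))) 0"
    by (simp add: finite_measure_axioms)
  have lw: "integrable (annulus_measure r s) (\<lambda>z. log_weight (c + z))"
  proof (rule integrable_const_bound)
    show "AE z in annulus_measure r s. norm (log_weight (c + z)) \<le> ln (1 + (cmod c + s)\<^sup>2) / 2"
      using AE_annulus_measure
    proof eventually_elim
      case (elim z)
      have "cmod (c + z) \<le> cmod c + s" using norm_triangle_ineq[of c z] elim by simp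
      then have "(cmod (c + z))\<^sup>2 \<le> (cmod c + s)\<^sup>2" by (intro power_mono) auto
      then have "ln (1 + (cmod (c + z))\<^sup>2) \<le> ln (1 + (cmod c + s)\<^sup>2)"
        by (intro ln_mono) (auto simp: add_pos_nonneg)
      then show ?case using log_weight_nonneg[of "c + z"] by (simp add: log_weight_def)
    qed
  qed measurable
  have "has_bochner_integral (annulus_measure r s)
    (\<lambda>z. (log_weight (c + z) + log_weight a)
      - (ln (cmod (z - (a - c))) - ln (max (cmod z) (cmod (a - c)))) - ln (max (cmod z) (cmod (a - c))))
    ((LINT z|annulus_measure r s. log_weight (c + z)) + log_weight a - 0 - log_mean r s (a - c))"
    using lw J log_mean_bounds(1)[OF rs, of "a - c"]
    by (intro has_bochner_integral_diff has_bochner_integral_add)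
      (auto simp: log_mean_def has_bochner_integral_iff prob_space[simplified])
  moreover have "(log_weight (c + z) + log_weight a)
      - (ln (cmod (z - (a - c))) - ln (max (cmod z) (cmod (a - c)))) - ln (max (cmod z) (cmod (a - c)))
      = green (c + z) a" for z
    by (simp add: green_def algebra_simps)
  ultimately show ?thesis by (simp add: has_bochner_integral_integral_eq)
qed

text \<open>The witness is the annulus density moved to centre \<open>c\<close> and divided by
  \<open>FS_density\<close>. It is bounded because \<open>FS_density\<close> is bounded below on
  bounded sets.\<close>

lemma green_potential_annulus:
  assumes rs: "0 < r" "r < s"
  obtains \<eta> C where "\<eta> \<in> borel_measurable borel" "\<And>z. \<bar>\<eta> z\<bar> \<le> C"
    "\<And>a. green_potential \<eta> a = (LINT z|annulus_measure r s. green (c + z) a)"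
proof
  define \<eta> where "\<eta> z = annulus_density r s (z - c) / FS_density z" for z
  show [measurable]: "\<eta> \<in> borel_measurable borel" unfolding \<eta>_def by measurable
  define m where "m = measure lborel (annulus r s)"
  have m: "0 < m" unfolding m_def by (rule measure_annulus_pos[OF rs])
  show "\<bar>\<eta> z\<bar> \<le> pi * (1 + (cmod c + s)\<^sup>2)\<^sup>2 / m" for z
  proof (cases "z - c \<in> annulus r s")
    case True
    then have "cmod z \<le> cmod c + s"
      using norm_triangle_ineq[of c "z - c"] by (simp add: annulus_def)
    then have "pi * (1 + (cmod z)\<^sup>2)\<^sup>2 \<le> pi * (1 + (cmod c + s)\<^sup>2)\<^sup>2"
      by (intro mult_left_mono power_mono add_left_mono) auto
    then show ?thesis
      using True m by (simp add: \<eta>_def annulus_density_def FS_density_def m_def[symmetric] divide_right_mono)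
  next
    case False
    then show ?thesis using m by (simp add: \<eta>_def annulus_density_def)
  qed
  show "green_potential \<eta> a = (LINT z|annulus_measure r s. green (c + z) a)" for a
  proof -
    have "green_potential \<eta> a = (LINT z|lborel. FS_density z *\<^sub>R (green z a * \<eta> z))"
      unfolding green_potential_def FS_def
      by (subst integral_density) (auto simp: less_imp_le[OF FS_density_pos])
    also have "\<dots> = (LINT z|lborel. annulus_density r s (z - c) * green z a)"
      using FS_density_pos by (intro Bochner_Integration.integral_cong) (auto simp: \<eta>_def less_imp_neq[symmetric])
    also have "\<dots> = (LINT z|lborel. annulus_density r s ((c + z) - c) * green (c + z) a)"
      by (rule integral_lborel_translate[symmetric]) measurable
    also have "\<dots> = (LINT z|annulus_measure r s. green (c + z) a)"
      by (subst integral_annulus_measure) auto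
    finally show ?thesis .
  qed
qed

text \<open>The gap between the two annuli makes the bump bounded away from \<open>0\<close> near the origin.\<close>

definition bump :: "real \<Rightarrow> complex \<Rightarrow> real" where
  "bump R b = log_mean (3 * R) (4 * R) b - log_mean R (2 * R) b"

lemma bump_nonneg: "0 < R \<Longrightarrow> 0 \<le> bump R b"
proof -
  assume R: "0 < R"
  have "ln (max (2 * R) (cmod b)) \<le> ln (max (3 * R) (cmod b))"
    using R by (intro ln_mono) auto
  moreover have "ln (max (3 * R) (cmod b)) \<le> log_mean (3 * R) (4 * R) b"
      "log_mean R (2 * R) b \<le> ln (max (2 * R) (cmod b))"
    using R by (auto intro!: log_mean_bounds)
  ultimately show ?thesis unfolding bump_def by linarith
qed

text \<open>\<open>4\<close> is the ratio of the largest radius to the smallest one.\<close>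

lemma bump_le: "0 < R \<Longrightarrow> bump R b \<le> ln 4"
proof -
  assume R: "0 < R"
  have "ln (max (4 * R) (cmod b)) \<le> ln (4 * max R (cmod b))"
    using R by (intro ln_mono) auto
  also have "\<dots> = ln 4 + ln (max R (cmod b))"
    using R by (intro ln_mult_pos) auto
  finally have "ln (max (4 * R) (cmod b)) \<le> ln 4 + ln (max R (cmod b))" .
  moreover have "log_mean (3 * R) (4 * R) b \<le> ln (max (4 * R) (cmod b))"
      "ln (max R (cmod b)) \<le> log_mean R (2 * R) b"
    using R by (auto intro!: log_mean_bounds)
  ultimately show ?thesis unfolding bump_def by linarith
qed

text \<open>Outside both annuli each logarithmic mean equals \<open>ln (cmod b)\<close>, so they
  cancel.\<close>

lemma bump_eq_0:
  assumes "0 < R" "4 * R \<le> cmod b"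
  shows "bump R b = 0"
proof -
  have "ln (cmod b) \<le> log_mean r s b \<and> log_mean r s b \<le> ln (cmod b)"
    if "0 < r" "r < s" "s \<le> 4 * R" for r s
    using log_mean_bounds(2,3)[OF that(1,2), of b] that assms by (simp add: max_def split: if_splits)
  from this[of "3 * R" "4 * R"] this[of R "2 * R"] assms show ?thesis
    by (simp add: bump_def)
qed

text \<open>\<open>3 / 2\<close> compares the inner radius of the outer annulus with the outer
  radius of the inner one. The bound gives the bump positive mass, so that it can be
  normalised.\<close>

lemma bump_ge:
  assumes "0 < R" "cmod b \<le> 2 * R"
  shows "ln (3 / 2) \<le> bump R b"
proof -
  have "ln (3 * R) \<le> log_mean (3 * R) (4 * R) b"
    using log_mean_bounds(2)[of "3 * R" "4 * R" b] assms by (simp add: max_absorb1)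
  moreover have "log_mean R (2 * R) b \<le> ln (2 * R)"
    using log_mean_bounds(3)[of R "2 * R" b] assms by (simp add: max_absorb1)
  moreover have "ln (3 * R) - ln (2 * R) = ln (3 / 2)"
    using assms by (simp add: ln_div ln_mult)
  ultimately show ?thesis by (simp add: bump_def)
qed

lemma bump_minus_commute: "bump R (x - y) = bump R (y - x)"
  by (simp add: bump_def log_mean_def norm_minus_commute)

lemma borel_measurable_log_mean:
  assumes "0 < r" "r < s"
  shows "log_mean r s \<in> borel_measurable borel"
proof -
  interpret prob_space "annulus_measure r s" by (rule prob_space_annulus_measure[OF assms])
  show ?thesis unfolding log_mean_def by measurable
qed

lemma borel_measurable_bump [measurable]: "0 < R \<Longrightarrow> bump R \<in> borel_measurable borel"
  unfolding bump_def
  by (intro borel_measurable_diff borel_measurable_log_mean) auto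

text \<open>In the difference of the Green potentials of two annuli about \<open>c\<close> the terms
  \<open>log_weight x\<close> cancel; what remains is a constant minus the bump.\<close>

lemma equidistributed_bump:
  fixes \<alpha> :: "nat \<Rightarrow> nat \<Rightarrow> complex"
  assumes L1: "(\<lambda>n. LINT z|FS. \<bar>(\<Sum>i<n. green z (\<alpha> n i)) / n - 1 / 2\<bar>) \<longlonglongrightarrow> 0"
    and R: "0 < R"
  shows "equidistributed \<alpha> (\<lambda>x. bump R (x - c))"
proof -
  obtain \<eta>1 C1 where 1: "\<eta>1 \<in> borel_measurable borel" "\<And>z. \<bar>\<eta>1 z\<bar> \<le> C1"
    "\<And>a. green_potential \<eta>1 a = (LINT z|annulus_measure (3 * R) (4 * R). green (c + z) a)"
    using green_potential_annulus[of "3 * R" "4 * R" c] R by auto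
  obtain \<eta>2 C2 where 2: "\<eta>2 \<in> borel_measurable borel" "\<And>z. \<bar>\<eta>2 z\<bar> \<le> C2"
    "\<And>a. green_potential \<eta>2 a = (LINT z|annulus_measure R (2 * R). green (c + z) a)"
    using green_potential_annulus[of R "2 * R" c] R by auto
  define k where "k = (LINT z|annulus_measure (3 * R) (4 * R). log_weight (c + z)) -
    (LINT z|annulus_measure R (2 * R). log_weight (c + z))"
  have "bump R (x - c) = k - (green_potential \<eta>1 x - green_potential \<eta>2 x)" for x
    using R by (simp add: 1(3) 2(3) integral_annulus_green k_def bump_def)
  moreover have "integrable FS (green_potential \<eta>1)" "integrable FS (green_potential \<eta>2)"
    using has_bochner_integral_green_potential[OF 1(1,2)] has_bochner_integral_green_potential[OF 2(1,2)]
    by (auto simp: has_bochner_integral_iff)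
  moreover have "equidistributed \<alpha> (green_potential \<eta>1)" "equidistributed \<alpha> (green_potential \<eta>2)"
    by (rule equidistributed_green_potential[OF L1 1(1,2)], rule equidistributed_green_potential[OF L1 2(1,2)])
  ultimately show ?thesis
    by (auto intro!: equidistributed_diff equidistributed_const)
qed

section \<open>Continuous test functions\<close>

lemma bump_integral:
  assumes R: "0 < R"
  shows "integrable lborel (bump R)" and "0 < (LINT z|lborel. bump R z)"
proof -
  have [measurable]: "bump R \<in> borel_measurable borel" using R by measurable
  have fin: "emeasure lborel (cball (0::complex) r) < \<infinity>" for r
    by (rule emeasure_lborel_cball_finite)
  show int: "integrable lborel (bump R)"
  proof (rule Bochner_Integration.integrable_bound)
    show "integrable lborel (\<lambda>z::complex. ln 4 * indicator (cball 0 (4 * R)) z :: real)"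
      using fin by simp
    show "AE z in lborel. norm (bump R z) \<le> norm (ln 4 * indicator (cball 0 (4 * R)) z :: real)"
      using bump_nonneg[OF R] bump_le[OF R] bump_eq_0[OF R]
      by (intro AE_I2) (auto simp: indicator_def)
  qed measurable
  have "0 < ln (3 / 2) * measure lborel (cball (0::complex) (2 * R))"
    using R by (intro mult_pos_pos) (auto simp: content_cball)
  also have "\<dots> = (LINT z|lborel. ln (3 / 2) * indicator (cball (0::complex) (2 * R)) z)"
    by simp
  also have "\<dots> \<le> (LINT z|lborel. bump R z)"
  proof (rule integral_mono[OF _ int])
    show "integrable lborel (\<lambda>z::complex. ln (3 / 2) * indicator (cball 0 (2 * R)) z :: real)"
      using fin by simp
  qed (use bump_nonneg[OF R] bump_ge[OF R] in \<open>auto simp: indicator_def\<close>)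
  finally show "0 < (LINT z|lborel. bump R z)" .
qed

text \<open>For each \<open>c\<close> the translated bump is equidistributed, so the point averages
  converge pointwise in \<open>c\<close>. They are dominated by \<open>ln 4 * norm (f c)\<close>;
  dominated convergence passes to the integral over \<open>c\<close>, and Fubini identifies the
  limit.\<close>

lemma equidistributed_convolution:
  fixes f :: "complex \<Rightarrow> complex" and \<alpha> :: "nat \<Rightarrow> nat \<Rightarrow> complex"
  assumes L1: "(\<lambda>n. LINT z|FS. \<bar>(\<Sum>i<n. green z (\<alpha> n i)) / n - 1 / 2\<bar>) \<longlonglongrightarrow> 0"
    and R: "0 < R" and f: "integrable lborel f"
  defines "F \<equiv> \<lambda>x. LINT c|lborel. bump R (x - c) *\<^sub>R f c"
  shows "equidistributed \<alpha> F" and "integrable FS F"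
proof -
  have [measurable]: "bump R \<in> borel_measurable borel" using R by measurable
  have [measurable]: "f \<in> borel_measurable borel" using f by auto
  have bump: "\<bar>bump R z\<bar> \<le> ln 4" for z using bump_nonneg[OF R, of z] bump_le[OF R, of z] by simp
  have bump_f: "norm (bump R z *\<^sub>R f c) \<le> ln 4 * norm (f c)" for z c
    using bump[of z] by (simp add: mult_right_mono)
  have int: "integrable lborel (\<lambda>c. bump R (x - c) *\<^sub>R f c)" for x
    by (rule Bochner_Integration.integrable_bound[of _ "\<lambda>c. ln 4 * norm (f c)"])
      (use f bump_f in auto)
  have int_bump: "integrable FS (\<lambda>x. bump R (x - c))" for c
    by (rule FS.integrable_const_bound[of _ "ln 4"]) (use bump in auto)
  interpret pair_sigma_finite lborel FS ..
  have prod: "integrable (lborel \<Otimes>\<^sub>M FS) (\<lambda>(c, x). bump R (x - c) *\<^sub>R f c)"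
  proof (rule Fubini_integrable)
    show "integrable lborel (\<lambda>c. LINT x|FS. norm (case (c, x) of (c, x) \<Rightarrow> bump R (x - c) *\<^sub>R f c))"
    proof (rule Bochner_Integration.integrable_bound[of _ "\<lambda>c. ln 4 * norm (f c)"])
      show "AE c in lborel. norm (LINT x|FS. norm (case (c, x) of (c, x) \<Rightarrow> bump R (x - c) *\<^sub>R f c)) \<le> norm (ln 4 * norm (f c))"
      proof (intro AE_I2)
        fix c
        have "(LINT x|FS. norm (bump R (x - c) *\<^sub>R f c)) \<le> (LINT x|FS. ln 4 * norm (f c))"
          by (intro integral_mono) (use int_bump[of c] bump_f in auto)
        then show "norm (LINT x|FS. norm (case (c, x) of (c, x) \<Rightarrow> bump R (x - c) *\<^sub>R f c)) \<le> norm (ln 4 * norm (f c))"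
          by (simp add: FS.prob_space[simplified])
      qed
    qed (use f in auto)
  qed (use int_bump in auto)
  have "(LINT x|FS. F x) = (LINT c|lborel. (LINT x|FS. bump R (x - c) *\<^sub>R f c))"
    unfolding F_def by (rule Fubini_integral[OF prod])
  also have "\<dots> = (LINT c|lborel. (LINT x|FS. bump R (x - c)) *\<^sub>R f c)"
    using int_bump by simp
  finally have F: "(LINT x|FS. F x) = (LINT c|lborel. (LINT x|FS. bump R (x - c)) *\<^sub>R f c)" .
  show "integrable FS F" unfolding F_def using integrable_snd[OF prod] by simp
  have avg: "(1 / real n) *\<^sub>R (\<Sum>i<n. F (\<alpha> n i)) =
      (LINT c|lborel. ((1 / real n) *\<^sub>R (\<Sum>i<n. bump R (\<alpha> n i - c))) *\<^sub>R f c)" for n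
    unfolding F_def
    by (subst Bochner_Integration.integral_sum[symmetric], rule int)
      (simp add: scaleR_sum_left[symmetric] flip: integral_scaleR_right)
  show "equidistributed \<alpha> F"
    unfolding equidistributed_def avg F
  proof (rule integral_dominated_convergence[where w = "\<lambda>c. ln 4 * norm (f c)"])
    show "AE c in lborel. (\<lambda>n. ((1 / real n) *\<^sub>R (\<Sum>i<n. bump R (\<alpha> n i - c))) *\<^sub>R f c)
        \<longlonglongrightarrow> (LINT x|FS. bump R (x - c)) *\<^sub>R f c"
      using equidistributed_bump[OF L1 R]
      by (intro AE_I2 tendsto_scaleR tendsto_const) (simp add: equidistributed_def)
    show "AE c in lborel. norm (((1 / real n) *\<^sub>R (\<Sum>i<n. bump R (\<alpha> n i - c))) *\<^sub>R f c) \<le> ln 4 * norm (f c)" for n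
    proof (intro AE_I2)
      fix c
      have "norm (\<Sum>i<n. bump R (\<alpha> n i - c)) \<le> (\<Sum>i<n. ln 4)"
        by (rule sum_norm_le) (use bump in auto)
      then have "norm ((1 / real n) *\<^sub>R (\<Sum>i<n. bump R (\<alpha> n i - c))) \<le> ln 4"
        by (cases "n = 0") (auto simp: divide_le_eq mult.commute)
      then show "norm (((1 / real n) *\<^sub>R (\<Sum>i<n. bump R (\<alpha> n i - c))) *\<^sub>R f c) \<le> ln 4 * norm (f c)"
        unfolding norm_scaleR[of _ "f c"] real_norm_def by (rule mult_right_mono) simp
    qed
    show "(\<lambda>c. ((1 / real n) *\<^sub>R (\<Sum>i<n. bump R (\<alpha> n i - c))) *\<^sub>R f c) \<in> borel_measurable lborel" for n
      by measurable
    show "(\<lambda>c. (LINT x|FS. bump R (x - c)) *\<^sub>R f c) \<in> borel_measurable lborel"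
      by measurable
  qed (use f in auto)
qed

text \<open>The normalised bump is a probability density vanishing outside radius
  \<open>4 * R\<close>, so the convolution at \<open>x\<close> is a weighted mean of values
  \<open>f c\<close> with \<open>c\<close> within \<open>4 * R\<close> of \<open>x\<close>.\<close>

lemma convolution_bump_close:
  fixes f :: "complex \<Rightarrow> complex"
  assumes R: "0 < R" and f: "integrable lborel f"
    and \<epsilon>: "\<And>c. cmod (c - x) \<le> 4 * R \<Longrightarrow> norm (f c - f x) \<le> \<epsilon>"
  shows "norm (f x - (1 / (LINT z|lborel. bump R z)) *\<^sub>R (LINT c|lborel. bump R (x - c) *\<^sub>R f c)) \<le> \<epsilon>"
proof -
  have [measurable]: "bump R \<in> borel_measurable borel" using R by measurable
  have [measurable]: "f \<in> borel_measurable borel" using f by auto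
  define m where "m = (LINT z|lborel. bump R z)"
  have m: "0 < m" unfolding m_def by (rule bump_integral[OF R])
  have bump: "\<bar>bump R z\<bar> \<le> ln 4" for z using bump_nonneg[OF R, of z] bump_le[OF R, of z] by simp
  have int: "integrable lborel (\<lambda>c. bump R (x - c) *\<^sub>R f c)"
    by (rule Bochner_Integration.integrable_bound[of _ "\<lambda>c. ln 4 * norm (f c)"])
      (use f bump in \<open>auto intro!: mult_right_mono\<close>)
  have b: "integrable lborel (\<lambda>c. bump R (x - c))" "(LINT c|lborel. bump R (x - c)) = m"
  proof -
    \<comment> \<open>Evenness of the bump reduces the reflection of \<open>c\<close> to a
      translation.\<close>
    have eq: "bump R (x - c) = bump R (- x + c)" for c
      using bump_minus_commute[of R x c] by simp
    show "(LINT c|lborel. bump R (x - c)) = m"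
      unfolding eq m_def by (rule integral_lborel_translate) measurable
    have "integrable (distr lborel borel (\<lambda>c. - x + c)) (bump R)"
      by (simp only: distr_lborel_translate bump_integral[OF R])
    then show "integrable lborel (\<lambda>c. bump R (x - c))"
      unfolding eq by (subst (asm) integrable_distr_eq) auto
  qed
  have "(LINT c|lborel. bump R (x - c) *\<^sub>R (f c - f x)) = (LINT c|lborel. bump R (x - c) *\<^sub>R f c) - m *\<^sub>R f x"
    using int b by (simp add: scaleR_diff_right)
  moreover have "norm (LINT c|lborel. bump R (x - c) *\<^sub>R (f c - f x)) \<le> (LINT c|lborel. bump R (x - c) * \<epsilon>)"
  proof -
    have "norm (LINT c|lborel. bump R (x - c) *\<^sub>R (f c - f x)) \<le>
        (LINT c|lborel. norm (bump R (x - c) *\<^sub>R (f c - f x)))"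
      by (rule integral_norm_bound)
    also have "\<dots> \<le> (LINT c|lborel. bump R (x - c) * \<epsilon>)"
    proof (rule integral_mono)
      show "integrable lborel (\<lambda>c. norm (bump R (x - c) *\<^sub>R (f c - f x)))"
        using int b by (intro integrable_norm) (simp add: scaleR_diff_right)
      show "norm (bump R (x - c) *\<^sub>R (f c - f x)) \<le> bump R (x - c) * \<epsilon>" for c
      proof (cases "cmod (c - x) \<le> 4 * R")
        case True
        then show ?thesis
          using \<epsilon> bump_nonneg[OF R] by (simp add: mult_left_mono)
      next
        case False
        then have "bump R (x - c) = 0"
          by (intro bump_eq_0 R) (simp add: norm_minus_commute)
        then show ?thesis by simp
      qed
    qed (use b in auto)
    finally show ?thesis .
  qed
  ultimately have le: "norm ((LINT c|lborel. bump R (x - c) *\<^sub>R f c) - m *\<^sub>R f x) \<le> m * \<epsilon>"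
    using b by simp
  have "f x - (1 / m) *\<^sub>R (LINT c|lborel. bump R (x - c) *\<^sub>R f c) =
      (- (1 / m)) *\<^sub>R ((LINT c|lborel. bump R (x - c) *\<^sub>R f c) - m *\<^sub>R f x)"
    using m by (simp add: scaleR_diff_right)
  also have "norm \<dots> = (1 / m) * norm ((LINT c|lborel. bump R (x - c) *\<^sub>R f c) - m *\<^sub>R f x)"
    using m by (simp only: norm_scaleR) simp
  also have "\<dots> \<le> (1 / m) * (m * \<epsilon>)"
    using le m by (intro mult_left_mono) auto
  finally show ?thesis using m by (simp add: m_def)
qed

text \<open>Uniform continuity makes convolutions with narrow normalised bumps uniformly close to
  \<open>f\<close>, and equidistribution survives uniform limits.\<close>

lemma equidistributed_compact_support:
  fixes f :: "complex \<Rightarrow> complex" and \<alpha> :: "nat \<Rightarrow> nat \<Rightarrow> complex"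
  assumes L1: "(\<lambda>n. LINT z|FS. \<bar>(\<Sum>i<n. green z (\<alpha> n i)) / n - 1 / 2\<bar>) \<longlonglongrightarrow> 0"
    and cont: "continuous_on UNIV f" and supp: "\<And>z. K \<le> cmod z \<Longrightarrow> f z = 0"
  shows "equidistributed \<alpha> f" and "integrable FS f"
proof -
  have [measurable]: "f \<in> borel_measurable borel"
    by (rule borel_measurable_continuous_onI[OF cont])
  have "compact (f ` cball 0 K)"
    by (intro compact_continuous_image continuous_on_subset[OF cont]) auto
  then obtain B where B: "\<And>z. cmod z \<le> K \<Longrightarrow> norm (f z) \<le> B"
    by (fastforce dest!: compact_imp_bounded simp: bounded_iff)
  have fB: "norm (f z) \<le> max B 0" for z
    using B[of z] supp[of z] by (cases "cmod z \<le> K") auto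
  show intFS: "integrable FS f"
    by (rule FS.integrable_const_bound[of _ "max B 0"]) (use fB in auto)
  have int: "integrable lborel f"
  proof (rule Bochner_Integration.integrable_bound)
    show "integrable lborel (\<lambda>z::complex. max B 0 * indicator (cball 0 K) z :: real)"
      using emeasure_lborel_cball_finite[of "0::complex" K] by simp
    show "AE z in lborel. norm (f z) \<le> norm (max B 0 * indicator (cball 0 K) z :: real)"
      using fB supp by (intro AE_I2) (auto simp: indicator_def)
  qed measurable
  show "equidistributed \<alpha> f"
  proof (rule equidistributed_uniform_closure[OF intFS])
    fix \<epsilon> :: real assume \<epsilon>: "0 < \<epsilon>"
    \<comment> \<open>The margin \<open>1\<close> ensures that when one of two points at distance
      below \<open>1\<close> lies in the ball of radius \<open>K\<close>, both lie in the larger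
      ball; if neither lies in the smaller ball, \<open>f\<close> vanishes at both.\<close>
    have "uniformly_continuous_on (cball 0 (K + 1)) f"
      by (intro compact_uniformly_continuous continuous_on_subset[OF cont]) auto
    then obtain d where d: "0 < d"
      "\<And>x y. x \<in> cball 0 (K + 1) \<Longrightarrow> y \<in> cball 0 (K + 1) \<Longrightarrow> dist y x < d \<Longrightarrow> dist (f y) (f x) < \<epsilon>"
      using \<epsilon> unfolding uniformly_continuous_on_def by metis
    \<comment> \<open>With this choice \<open>4 * R\<close> is half of \<open>min d 1\<close>, hence
      below both \<open>d\<close> and \<open>1\<close>.\<close>
    define R where "R = min d 1 / 8"
    have R: "0 < R" "4 * R < d" "4 * R < 1" using d(1) by (auto simp: R_def min_def)
    have close: "norm (f c - f x) \<le> \<epsilon>" if "cmod (c - x) \<le> 4 * R" for c x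
    proof (cases "cmod c \<le> K \<or> cmod x \<le> K")
      case True
      have "\<bar>cmod c - cmod x\<bar> \<le> cmod (c - x)" by (rule norm_triangle_ineq3)
      with True that R have "c \<in> cball 0 (K + 1)" "x \<in> cball 0 (K + 1)" by auto
      then have "dist (f c) (f x) < \<epsilon>"
        using that R by (intro d(2)) (auto simp: dist_norm)
      then show ?thesis by (simp add: dist_norm)
    next
      case False
      then show ?thesis using supp[of c] supp[of x] \<epsilon> by simp
    qed
    let ?g = "\<lambda>x. (1 / (LINT z|lborel. bump R z)) *\<^sub>R (LINT c|lborel. bump R (x - c) *\<^sub>R f c)"
    have "equidistributed \<alpha> ?g" "integrable FS ?g"
      using equidistributed_convolution[OF L1 R(1) int]
      by (auto intro: equidistributed_scaleR)
    moreover have "norm (f x - ?g x) \<le> \<epsilon>" for x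
      using convolution_bump_close[OF R(1) int close] .
    ultimately show "\<exists>g. equidistributed \<alpha> g \<and> integrable FS g \<and> (\<forall>z. norm (f z - g z) \<le> \<epsilon>)"
      by blast
  qed
qed

text \<open>Cutting off \<open>f - L\<close> far out and adding \<open>L\<close> back approximates
  \<open>f\<close> uniformly by a compactly supported function plus a constant.\<close>

lemma equidistributed_limit_at_infinity:
  fixes f :: "complex \<Rightarrow> complex" and \<alpha> :: "nat \<Rightarrow> nat \<Rightarrow> complex"
  assumes L1: "(\<lambda>n. LINT z|FS. \<bar>(\<Sum>i<n. green z (\<alpha> n i)) / n - 1 / 2\<bar>) \<longlonglongrightarrow> 0"
    and cont: "continuous_on UNIV f" and lim: "(f \<longlongrightarrow> L) at_infinity"
  shows "equidistributed \<alpha> f"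
proof -
  have approx: "\<exists>g. equidistributed \<alpha> g \<and> integrable FS g \<and> (\<forall>z. norm (f z - g z) \<le> \<epsilon>)"
    if \<epsilon>: "0 < \<epsilon>" for \<epsilon>
  proof -
    obtain K where K: "\<And>z. K \<le> cmod z \<Longrightarrow> norm (f z - L) < \<epsilon>"
      using tendstoD[OF lim \<epsilon>] by (auto simp: eventually_at_infinity dist_norm)
    \<comment> \<open>\<open>cut\<close> is \<open>1\<close> for \<open>cmod z \<le> K\<close> and
      \<open>0\<close> for \<open>cmod z \<ge> K + 1\<close>, so the error
      \<open>(1 - cut z) * norm (f z - L)\<close> occurs only where \<open>f\<close> is already
      close to \<open>L\<close>.\<close>
    define cut where "cut z = max 0 (min 1 (K + 1 - cmod z))" for z
    have cut: "0 \<le> cut z" "cut z \<le> 1" for z by (auto simp: cut_def)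
    define g where "g z = cut z *\<^sub>R (f z - L)" for z
    have "continuous_on UNIV g"
      unfolding g_def cut_def by (intro continuous_intros cont)
    moreover have "g z = 0" if "K + 1 \<le> cmod z" for z
      using that by (simp add: g_def cut_def)
    ultimately have g: "equidistributed \<alpha> g" "integrable FS g"
      using equidistributed_compact_support[OF L1, of g "K + 1"] by auto
    have "norm (f z - (g z + L)) \<le> \<epsilon>" for z
    proof -
      have "f z - (g z + L) = (1 - cut z) *\<^sub>R (f z - L)"
        by (simp add: g_def scaleR_diff_left)
      then have eq: "norm (f z - (g z + L)) = (1 - cut z) * norm (f z - L)"
        using cut[of z] by simp
      show ?thesis
      proof (cases "K \<le> cmod z")
        case True
        then have "(1 - cut z) * norm (f z - L) \<le> 1 * norm (f z - L)"
          using cut[of z] by (intro mult_right_mono) auto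
        with K[OF True] eq show ?thesis by simp
      next
        case False
        then have "cut z = 1" by (simp add: cut_def)
        with eq \<epsilon> show ?thesis by simp
      qed
    qed
    moreover have "equidistributed \<alpha> (\<lambda>z. g z + L)" "integrable FS (\<lambda>z. g z + L)"
      using g by (auto intro!: equidistributed_add equidistributed_const)
    ultimately show ?thesis by blast
  qed
  have [measurable]: "f \<in> borel_measurable borel"
    by (rule borel_measurable_continuous_onI[OF cont])
  have "integrable FS f"
  proof -
    obtain g where g: "integrable FS g" "\<And>z. norm (f z - g z) \<le> 1"
      using approx[of 1] by auto
    have [measurable]: "g \<in> borel_measurable FS" using g by auto
    have "integrable FS (\<lambda>z. f z - g z)"
      by (rule FS.integrable_const_bound[of _ 1]) (use g in auto)
    from Bochner_Integration.integrable_add[OF this g(1)] show ?thesis by simp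
  qed
  then show ?thesis by (rule equidistributed_uniform_closure) (rule approx)
qed

section \<open>The area form and the conclusion for zeros of polynomials\<close>

lemma integral_FS_eq_area_form_integral:
  fixes f :: "complex \<Rightarrow> complex"
  assumes [measurable]: "f \<in> borel_measurable borel"
  shows "(LINT z|FS. f z) = area_form_integral (\<lambda>z. f z / (1 + complex_of_real ((cmod z)\<^sup>2))\<^sup>2)"
proof -
  have "(LINT z|FS. f z) = (LINT z|lborel. FS_density z *\<^sub>R f z)"
    unfolding FS_def by (subst integral_density) (auto simp: less_imp_le[OF FS_density_pos])
  also have "\<dots> = (LINT z|lborel. (1 / complex_of_real pi) * (f z / (1 + complex_of_real ((cmod z)\<^sup>2))\<^sup>2))"
    by (simp add: FS_density_def scaleR_conv_of_real)
  also have "\<dots> = area_form_integral (\<lambda>z. f z / (1 + complex_of_real ((cmod z)\<^sup>2))\<^sup>2)"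
    unfolding area_form_integral_def by (rule integral_mult_right_zero)
  finally show ?thesis .
qed

theorem proposition1p7:
  fixes P :: "nat \<Rightarrow> complex poly" and f :: "complex \<Rightarrow> complex"
  assumes deg: "\<And>n. n \<ge> 1 \<Longrightarrow> degree (P n) = n"
    and heights: "limsup (\<lambda>n. ereal (h_B (P n) + 1 / 2 - h_FS (P n))) \<le> 0"
    and cont: "continuous_on UNIV f"
    and lim_infinity: "\<exists>L. (f \<longlongrightarrow> L) at_infinity"
  shows "(\<lambda>n. 1 / of_nat n * (\<Sum>z\<in>#proots (P n). f z))
    \<longlonglongrightarrow> area_form_integral (\<lambda>z. f z / (1 + complex_of_real ((cmod z)\<^sup>2))\<^sup>2)"
proof -
  have "\<exists>r. proots (P n) = image_mset r (mset_set {..<degree (P n)})" for n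
    by (metis complex_poly_roots_enum)
  then obtain \<alpha> :: "nat \<Rightarrow> nat \<Rightarrow> complex"
    where "\<And>n. proots (P n) = image_mset (\<alpha> n) (mset_set {..<degree (P n)})" by metis
  \<comment> \<open>The degree of \<open>P 0\<close> is unspecified, so the index range is
    identified only for \<open>n \<ge> 1\<close>, which suffices for the limit.\<close>
  then have \<alpha>: "proots (P n) = image_mset (\<alpha> n) (mset_set {..<n})" if "n \<ge> 1" for n
    using deg[OF that] by metis
  let ?x = "\<lambda>n. h_B (P n) + 1 / 2 - h_FS (P n)"
  \<comment> \<open>An upper bound on the limit superior says nothing about very negative values; it
    is the positive part that tends to \<open>0\<close>.\<close>
  have x: "(\<lambda>n. max 0 (?x n)) \<longlonglongrightarrow> 0"
  proof (rule tendstoI)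
    fix e :: real assume e: "0 < e"
    then have "limsup (\<lambda>n. ereal (?x n)) < ereal e"
      using heights by (metis ereal_less(2) order_le_less_trans)
    then have "\<forall>\<^sub>F n in sequentially. ereal (?x n) < ereal e" by (rule Limsup_lessD)
    then show "\<forall>\<^sub>F n in sequentially. dist (max 0 (?x n)) 0 < e"
      by eventually_elim (use e in auto)
  qed
  moreover have "(\<lambda>n. ln (real n + 1) / (2 * n)) \<longlonglongrightarrow> 0" by real_asymp
  ultimately have bound: "(\<lambda>n. 2 * (max 0 (?x n) + ln (real n + 1) / (2 * n))) \<longlonglongrightarrow> 0"
    by (intro tendsto_mult_right_zero tendsto_add_zero)
  have L1: "(\<lambda>n. LINT z|FS. \<bar>(\<Sum>i<n. green z (\<alpha> n i)) / n - 1 / 2\<bar>) \<longlonglongrightarrow> 0"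
  proof (rule tendsto_sandwich[OF _ _ tendsto_const bound])
    show "\<forall>\<^sub>F n in sequentially. (LINT z|FS. \<bar>(\<Sum>i<n. green z (\<alpha> n i)) / n - 1 / 2\<bar>)
        \<le> 2 * (max 0 (?x n) + ln (real n + 1) / (2 * n))"
      using eventually_ge_at_top[of 1]
      by eventually_elim (rule average_green_L1_bound[OF \<alpha> deg])
    show "\<forall>\<^sub>F n in sequentially. 0 \<le> (LINT z|FS. \<bar>(\<Sum>i<n. green z (\<alpha> n i)) / n - 1 / 2\<bar>)"
      by (intro always_eventually allI Bochner_Integration.integral_nonneg) auto
  qed
  obtain L where "(f \<longlongrightarrow> L) at_infinity" using lim_infinity by blast
  from equidistributed_limit_at_infinity[OF L1 cont this]
  have lim: "(\<lambda>n. (1 / real n) *\<^sub>R (\<Sum>i<n. f (\<alpha> n i))) \<longlonglongrightarrow> (LINT z|FS. f z)"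
    by (simp add: equidistributed_def)
  have eq: "\<forall>\<^sub>F n in sequentially. (1 / real n) *\<^sub>R (\<Sum>i<n. f (\<alpha> n i)) =
      1 / of_nat n * (\<Sum>z\<in>#proots (P n). f z)"
    using eventually_ge_at_top[of 1]
    by eventually_elim
      (simp add: \<alpha> image_mset.compositionality comp_def sum_unfold_sum_mset scaleR_conv_of_real)
  have "(LINT z|FS. f z) = area_form_integral (\<lambda>z. f z / (1 + complex_of_real ((cmod z)\<^sup>2))\<^sup>2)"
    by (intro integral_FS_eq_area_form_integral borel_measurable_continuous_onI cont)
  with Lim_transform_eventually[OF lim eq] show ?thesis by (simp only:)
qed

end
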